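(* Let $0<\alpha<1$, let $b>0$, and let $f\in H^{1}(0,b)$ (identified with its continuous representative on $[0,b]$) be such that the Atangana-Baleanu fractional derivatives ${}^{\mathrm{ABR}}_{0}D_{t}^{\alpha} f(t)$ (Riemann-Liouville sense) and ${}^{\mathrm{ABC}}_{0}D_{t}^{\alpha} f(t)$ (Caputo sense) of order $\alpha$ with base point $0$ exist at every $t\in(0,b)$. Then for every $t\in(0,b)$ $${}^{\mathrm{AB}}_{0}I_{t}^{\alpha}\left\{{}^{\mathrm{ABR}}_{0}D_{t}^{\alpha} f(t)\right\}=f(t),$$ $${}^{\mathrm{AB}}_{0}I_{t}^{\alpha}\left\{{}^{\mathrm{ABC}}_{0}D_{t}^{\alpha} f(t)\right\}=f(t)-f(0),$$ where ${}^{\mathrm{AB}}_{0}I_{t}^{\alpha}$ is the Atangana-Baleanu fractional integral of order $\alpha$ with base point $0$.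
   Context: $H^{1}(0,b)=\{v\in L^{2}(0,b) : v'\in L^{2}(0,b)\}$, where $v'$ is the distributional derivative. The Mittag-Leffler function is $E_\alpha(z)=\sum_{k=0}^\infty \frac{z^k}{\Gamma(\alpha k+1)}$ for $\alpha>0$. $B(\alpha)$ is a nonzero real normalization constant depending only on $\alpha$ (the same constant in all three definitions below); one natural choice is $B(\alpha)=1-\alpha+\frac{\alpha}{\Gamma(\alpha)}$. Atangana-Baleanu fractional derivative of $f$ of order $\alpha$ in the Caputo sense, with base point $0$, at $t\in(0,b)$: $${}^{\mathrm{ABC}}_{0}D_{t}^{\alpha} f(t)=\frac{B(\alpha)}{1-\alpha}\int_{0}^{t} f'(x)\,E_{\alpha}\left[-\alpha\frac{(t-x)^{\alpha}}{1-\alpha}\right]dx.$$ Atangana-Baleanu fractional derivative of $f$ of order $\alpha$ in the Riemann-Liouville sense, with base point $0$, at $t\in(0,b)$: $${}^{\mathrm{ABR}}_{0}D_{t}^{\alpha} f(t)=\frac{B(\alpha)}{1-\alpha}\frac{d}{dt}\int_{0}^{t} f(x)\,E_{\alpha}\left[-\alpha\frac{(t-x)^{\alpha}}{1-\alpha}\right]dx.$$ Atangana-Baleanu fractional integral of order $\alpha$ with base point $0$ of a function $g$ on $(0,b)$: $${}^{\mathrm{AB}}_{0}I_{t}^{\alpha} g(t)=\frac{1-\alpha}{B(\alpha)}g(t)+\frac{\alpha}{B(\alpha)\Gamma(\alpha)}\int_{0}^{t} g(y)(t-y)^{\alpha-1}\,dy.$$ In the claim, the integral is applied to the function $g(t)={}^{\mathrm{ABR}}_{0}D_{t}^{\alpha}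 f(t)$, respectively $g(t)={}^{\mathrm{ABC}}_{0}D_{t}^{\alpha} f(t)$. *)

theory Defs
  imports "HOL-Analysis.Analysis"
begin

definition square_integrable_on :: "(real \<Rightarrow> real) \<Rightarrow> real set \<Rightarrow> bool" where
  "square_integrable_on v S \<longleftrightarrow>
     set_borel_measurable lebesgue S v \<and> set_integrable lebesgue S (\<lambda>x. (v x)\<^sup>2)"

definition locally_integrable_on :: "(real \<Rightarrow> real) \<Rightarrow> real set \<Rightarrow> bool" where
  "locally_integrable_on v S \<longleftrightarrow>
     (\<forall>K. compact K \<and> K \<subseteq> S \<longrightarrow> set_integrable lebesgue K v)"

definition test_function :: "real set \<Rightarrow> (real \<Rightarrow> real) \<Rightarrow> bool" where
  "test_function S \<phi> \<longleftrightarrow>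
     (\<forall>n x. (deriv ^^ n) \<phi> differentiable (at x)) \<and>
     compact (closure {x. \<phi> x \<noteq> 0}) \<and> closure {x. \<phi> x \<noteq> 0} \<subseteq> S"

definition has_weak_derivative_on :: "(real \<Rightarrow> real) \<Rightarrow> (real \<Rightarrow> real) \<Rightarrow> real set \<Rightarrow> bool" where
  "has_weak_derivative_on v w S \<longleftrightarrow>
     locally_integrable_on v S \<and> locally_integrable_on w S \<and>
     (\<forall>\<phi>. test_function S \<phi> \<longrightarrow>
        (LINT x:S|lebesgue. v x * deriv \<phi> x) = - (LINT x:S|lebesgue. w x * \<phi> x))"

text \<open>A representative of the distributional derivative, which is only determined up to a
  null set. It is used below under the integral sign only, where the choice does not matter.\<close>

definition weak_derivative :: "real set \<Rightarrow> (real \<Rightarrow> real) \<Rightarrow> real \<Rightarrow> real" where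
  "weak_derivative S v = (SOME w. has_weak_derivative_on v w S)"

definition sobolev_H1 :: "real set \<Rightarrow> (real \<Rightarrow> real) set" where
  "sobolev_H1 S = {v. square_integrable_on v S \<and>
     (\<exists>w. has_weak_derivative_on v w S \<and> square_integrable_on w S)}"

definition mittag_leffler :: "real \<Rightarrow> 'a::{real_normed_field, banach} \<Rightarrow> 'a" where
  "mittag_leffler \<alpha> z = (\<Sum>k. z ^ k / of_real (Gamma (\<alpha> * real k + 1)))"

definition AB_kernel :: "real \<Rightarrow> real \<Rightarrow> real" where
  "AB_kernel \<alpha> s = mittag_leffler \<alpha> (- \<alpha> * (s powr \<alpha> / (1 - \<alpha>)))"

text \<open>Each operator comes with a predicate saying that its defining expression makes sense
  at the point \<open>t\<close>, since \<open>LINT\<close> and \<open>deriv\<close> are total. The normalization is a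
  function \<open>B\<close> of the order.\<close>

definition ABC_exists :: "real \<Rightarrow> real \<Rightarrow> (real \<Rightarrow> real) \<Rightarrow> real \<Rightarrow> bool" where
  "ABC_exists \<alpha> b f t \<longleftrightarrow>
     set_integrable lebesgue {0<..<t} (\<lambda>x. weak_derivative {0<..<b} f x * AB_kernel \<alpha> (t - x))"

definition ABC_derivative ::
    "(real \<Rightarrow> real) \<Rightarrow> real \<Rightarrow> real \<Rightarrow> (real \<Rightarrow> real) \<Rightarrow> real \<Rightarrow> real" where
  "ABC_derivative B \<alpha> b f t =
     B \<alpha> / (1 - \<alpha>) *
     (LINT x:{0<..<t}|lebesgue. weak_derivative {0<..<b} f x * AB_kernel \<alpha> (t - x))"

definition ABR_exists :: "real \<Rightarrow> (real \<Rightarrow> real) \<Rightarrow> real \<Rightarrow> bool" where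
  "ABR_exists \<alpha> f t \<longleftrightarrow>
     (\<forall>\<^sub>F s in nhds t. set_integrable lebesgue {0<..<s} (\<lambda>x. f x * AB_kernel \<alpha> (s - x))) \<and>
     (\<lambda>s. LINT x:{0<..<s}|lebesgue. f x * AB_kernel \<alpha> (s - x)) differentiable (at t)"

definition ABR_derivative ::
    "(real \<Rightarrow> real) \<Rightarrow> real \<Rightarrow> (real \<Rightarrow> real) \<Rightarrow> real \<Rightarrow> real" where
  "ABR_derivative B \<alpha> f t =
     B \<alpha> / (1 - \<alpha>) *
     deriv (\<lambda>s. LINT x:{0<..<s}|lebesgue. f x * AB_kernel \<alpha> (s - x)) t"

definition AB_integral_exists :: "real \<Rightarrow> (real \<Rightarrow> real) \<Rightarrow> real \<Rightarrow> bool" where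
  "AB_integral_exists \<alpha> g t \<longleftrightarrow>
     set_integrable lebesgue {0<..<t} (\<lambda>y. g y * (t - y) powr (\<alpha> - 1))"

definition AB_integral ::
    "(real \<Rightarrow> real) \<Rightarrow> real \<Rightarrow> (real \<Rightarrow> real) \<Rightarrow> real \<Rightarrow> real" where
  "AB_integral B \<alpha> g t =
     (1 - \<alpha>) / B \<alpha> * g t +
     \<alpha> / (B \<alpha> * Gamma \<alpha>) * (LINT y:{0<..<t}|lebesgue. g y * (t - y) powr (\<alpha> - 1))"

end

theory Submission
  imports Defs "HOL-Computational_Algebra.Polynomial"
begin

text \<open>Write \<open>E\<close> for the kernel \<open>AB_kernel \<alpha>\<close> and \<open>c = \<alpha> / ((1 - \<alpha>) \<Gamma>(\<alpha>))\<close>. Integrating the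
  Mittag-Leffler series termwise against a Beta integral gives the Volterra identity
  \<open>E(s) + c \<integral>\<^sub>0\<^sup>s E(u) (s - u) powr (\<alpha> - 1) du = 1\<close>. The Caputo derivative is a constant times the
  convolution \<open>f' * E\<close>, so by associativity of convolution the fractional integral turns it into
  \<open>f' * 1 = f - f(0)\<close>. For the Riemann-Liouville derivative, \<open>f = f(0) + f' * 1\<close> yields
  \<open>f * E = (f(0) E + f' * E) * 1\<close>; the function in parentheses is continuous, hence equal to the derivative
  of the left-hand side, and the Volterra identity recovers \<open>f(0) + (f - f(0))\<close>.
  The formula \<open>f = f(0) + f' * 1\<close> itself comes from testing the weak derivative against smooth
  approximations of the indicator function of an interval.\<close>

subsection \<open>The Mittag-Leffler kernel\<close>

text \<open>On \<open>{R..}\<close> the Gamma integrand dominates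
  \<open>R powr x * exp (- t)\<close>, whose integral there is the left-hand side. Since R is free,
  Gamma outgrows every geometric sequence.\<close>

lemma Gamma_ge_powr_exp:
  fixes x R :: real
  assumes "0 < R" "0 \<le> x"
  shows "R powr x * exp (- R) \<le> Gamma (x + 1)"
proof -
  have "((\<lambda>t. exp (- 1 * t)) has_integral exp (- 1 * R) / 1) {R..}"
    by (rule has_integral_exp_minus_to_infinity) simp
  then have "((\<lambda>t. R powr x * exp (- t)) has_integral R powr x * exp (- R)) {R..}"
    by (intro has_integral_mult_right) simp
  then have I: "((\<lambda>t. if t \<in> {R..} then R powr x * exp (- t) else 0) has_integral
      R powr x * exp (- R)) {0..}"
    using assms by (subst has_integral_restrict) auto
  have J: "((\<lambda>t. t powr x / exp t) has_integral Gamma (x + 1)) {0..}"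
    using Gamma_integral_real[of "x + 1"] assms by simp
  show ?thesis
    by (rule has_integral_le[OF I J])
      (use assms in \<open>auto simp: exp_minus divide_inverse intro!: powr_mono2\<close>)
qed

lemma summable_mittag_leffler:
  fixes z :: real
  assumes "0 < \<alpha>"
  shows "summable (\<lambda>k. z ^ k / Gamma (\<alpha> * real k + 1))"
proof -
  \<comment> \<open>This choice makes R powr \<alpha> exceed 2|z|, so the terms of the series decay
    like \<open>exp R * (1/2) ^ k\<close>; the summand 1 keeps R positive when z = 0.\<close>
  define R where "R = (2 * \<bar>z\<bar> + 1) powr (1 / \<alpha>)"
  have R: "0 < R" "R powr \<alpha> = 2 * \<bar>z\<bar> + 1"
    using assms by (simp_all add: R_def powr_powr)
  have pos: "0 < Gamma (\<alpha> * real k + 1)" for k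
    using assms by (intro Gamma_real_pos) (simp add: add_nonneg_pos)
  have "norm (z ^ k / Gamma (\<alpha> * real k + 1)) \<le> exp R * (1/2) ^ k" for k
  proof -
    have "(2 * \<bar>z\<bar>) ^ k * exp (- R) \<le> (2 * \<bar>z\<bar> + 1) ^ k * exp (- R)"
      by (intro mult_right_mono power_mono) auto
    also have "\<dots> = R powr (\<alpha> * real k) * exp (- R)"
      using R by (simp add: powr_powr[symmetric] powr_realpow del: powr_powr)
    also have "\<dots> \<le> Gamma (\<alpha> * real k + 1)"
      using R assms by (intro Gamma_ge_powr_exp) auto
    finally show ?thesis
      using pos[of k] by (simp add: field_simps exp_minus power_mult_distrib power_abs abs_mult)
  qed
  then have bound: "norm (z ^ k / Gamma (\<alpha> * real k + 1)) \<le> exp R * (1/2) ^ k" for k .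
  have "summable (\<lambda>k. exp R * (1/2) ^ k)"
    by (rule summable_mult, rule summable_geometric) simp
  then show ?thesis
    using bound by (rule summable_comparison_test')
qed

lemma continuous_on_mittag_leffler:
  assumes "0 < \<alpha>"
  shows "continuous_on UNIV (mittag_leffler \<alpha> :: real \<Rightarrow> real)"
proof -
  have "isCont (\<lambda>x. \<Sum>k. (1 / Gamma (\<alpha> * real k + 1)) * x ^ k) z" for z :: real
    using summable_mittag_leffler[OF assms]
    by (intro isCont_powser_converges_everywhere) simp
  then show ?thesis
    unfolding mittag_leffler_def by (simp add: continuous_on_eq_continuous_at)
qed

lemma continuous_on_AB_kernel:
  assumes "0 < \<alpha>"
  shows "continuous_on {0..} (AB_kernel \<alpha>)"
proof -
  \<comment> \<open>The constant factor is written as an inverse, so that no condition \<alpha>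
    \<noteq> 1 arises.\<close>
  have "continuous_on {0..} (\<lambda>s::real. - \<alpha> * (s powr \<alpha> * inverse (1 - \<alpha>)))"
    using assms by (intro continuous_intros continuous_on_powr') auto
  then have "continuous_on {0..} (\<lambda>s. mittag_leffler \<alpha> (- \<alpha> * (s powr \<alpha> * inverse (1 - \<alpha>))))"
    by (rule continuous_on_compose2[OF continuous_on_mittag_leffler[OF assms]]) auto
  then show ?thesis
    unfolding AB_kernel_def[abs_def] divide_inverse .
qed

lemma AB_kernel_0:
  "AB_kernel \<alpha> 0 = 1"
  using powser_zero[of "\<lambda>k. 1 / Gamma (\<alpha> * real k + 1)"]
  by (simp add: AB_kernel_def mittag_leffler_def)

text \<open>Substitute u = s x in the Beta integral over [0,1]: the two powers contribute
  \<open>s powr (a + b - 2)\<close> and the change of variables one more factor s.\<close>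

lemma has_integral_Beta_scaled:
  fixes a b s :: real
  assumes "0 < a" "0 < b" "0 < s"
  shows "((\<lambda>u. u powr (a - 1) * (s - u) powr (b - 1)) has_integral s powr (a + b - 1) * Beta a b) {0..s}"
proof -
  have "((\<lambda>x. (inverse s * x + 0) powr (a - 1) * (1 - (inverse s * x + 0)) powr (b - 1))
      has_integral (Beta a b /\<^sub>R inverse s ^ DIM(real)))
      (cbox ((0 - 0) /\<^sub>R inverse s) ((1 - 0) /\<^sub>R inverse s))"
    using has_integral_affinity'[of "\<lambda>x. x powr (a - 1) * (1 - x) powr (b - 1)" "Beta a b" 0 1
        "inverse s" 0] has_integral_Beta_real[OF assms(1,2)] assms by simp
  then have I: "((\<lambda>x. (x / s) powr (a - 1) * (1 - x / s) powr (b - 1)) has_integral (Beta a b * s)) {0..s}"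
    using assms by (simp add: divide_inverse mult.commute)
  have "((\<lambda>x. s powr (a + b - 2) * ((x / s) powr (a - 1) * (1 - x / s) powr (b - 1))) has_integral
      s powr (a + b - 2) * (Beta a b * s)) {0..s}"
    by (rule has_integral_mult_right[OF I])
  moreover have "s powr (a + b - 2) * ((x / s) powr (a - 1) * (1 - x / s) powr (b - 1)) =
      x powr (a - 1) * (s - x) powr (b - 1)" if "x \<in> {0..s}" for x
  proof -
    have "1 - x / s = (s - x) / s" using assms by (simp add: field_simps)
    moreover have "s powr (a + b - 2) = s powr (a - 1) * s powr (b - 1)"
      by (simp flip: powr_add add: algebra_simps)
    ultimately show ?thesis
      using assms that by (simp add: powr_divide field_simps)
  qed
  moreover have "s powr (a + b - 2) * (Beta a b * s) = s powr (a + b - 1) * Beta a b"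
    using assms powr_add[of s "a + b - 2" 1] by (simp add: algebra_simps)
  ultimately show ?thesis
    by (subst has_integral_cong[symmetric]) auto
qed

text \<open>The integrand is nonnegative, so its gauge integral is also its Lebesgue
  integral.\<close>

lemma has_bochner_integral_Beta_scaled:
  fixes a b s :: real
  assumes "0 < a" "0 < b" "0 < s"
  shows "has_bochner_integral lborel
    (\<lambda>u. indicator {0<..<s} u * (u powr (a - 1) * (s - u) powr (b - 1)))
    (s powr (a + b - 1) * (Gamma a * Gamma b / Gamma (a + b)))"
proof (rule has_bochner_integral_nn_integral)
  have "((\<lambda>u. u powr (a - 1) * (s - u) powr (b - 1)) has_integral s powr (a + b - 1) * Beta a b) {0<..<s}"
    using has_integral_Beta_scaled[OF assms] by (simp add: has_integral_Icc_iff_Ioo)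
  then have "(\<integral>\<^sup>+u. ennreal (indicator {0<..<s} u * (u powr (a - 1) * (s - u) powr (b - 1))) \<partial>lborel)
      = ennreal (s powr (a + b - 1) * Beta a b)"
    using assms by (intro nn_integral_has_integral_lebesgue) auto
  then show "(\<integral>\<^sup>+u. ennreal (indicator {0<..<s} u * (u powr (a - 1) * (s - u) powr (b - 1))) \<partial>lborel)
      = ennreal (s powr (a + b - 1) * (Gamma a * Gamma b / Gamma (a + b)))"
    by (simp add: Beta_def)
qed (use assms in \<open>auto intro!: mult_nonneg_nonneg divide_nonneg_nonneg Gamma_real_nonneg\<close>)

text \<open>By the Beta integral, integrating term k of the series against the power kernel gives
  term k + 1 up to the fixed factor \<open>Gamma \<alpha> / (- c)\<close>. The sum of the integrals
  is therefore the same series without its first term 1.\<close>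

lemma AB_kernel_volterra:
  assumes \<alpha>: "0 < \<alpha>" "\<alpha> < 1" and s: "0 < s"
  shows "AB_kernel \<alpha> s + \<alpha> / ((1 - \<alpha>) * Gamma \<alpha>) *
    (\<integral>u. indicator {0<..<s} u * (AB_kernel \<alpha> u * (s - u) powr (\<alpha> - 1)) \<partial>lborel) = 1"
proof -
  \<comment> \<open>This constant omits the factor 1 / \<Gamma>(\<alpha>), so that E(s) is the
    Mittag-Leffler series at - c s powr \<alpha>.\<close>
  define c where "c = \<alpha> / (1 - \<alpha>)"
  define G where "G k = Gamma (\<alpha> * real k + 1)" for k
  define g where "g k u = (- c) ^ k / G k *
      (indicator {0<..<s} u * (u powr ((\<alpha> * real k + 1) - 1) * (s - u) powr (\<alpha> - 1)))" for k u
  \<comment> \<open>The scaled Beta integral belonging to term k, divided by \<open>G k\<close>; its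
    denominator is \<open>G (Suc k)\<close> because \<alpha> k + 1 + \<alpha> = \<alpha> (k + 1) +
    1.\<close>
  define I where "I k = Gamma \<alpha> * s powr \<alpha> * (s powr \<alpha>) ^ k / G (Suc k)" for k
  have Gpos: "0 < G k" for k
    unfolding G_def using \<alpha> by (intro Gamma_real_pos) (simp add: add_nonneg_pos)
  have G0: "0 < Gamma \<alpha>" using \<alpha> by (intro Gamma_real_pos)
  have cpos: "0 < c" using \<alpha> by (simp add: c_def)
  have E: "AB_kernel \<alpha> u = (\<Sum>k. (- c * u powr \<alpha>) ^ k / G k)" for u
    by (simp add: AB_kernel_def mittag_leffler_def c_def G_def)
  have Epow: "(\<lambda>k. (- c * u powr \<alpha>) ^ k / G k) sums AB_kernel \<alpha> u" for u
    unfolding E G_def using summable_mittag_leffler[OF \<alpha>(1)] by (rule summable_sums)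
  have eq: "s powr (\<alpha> * real k + 1 + \<alpha> - 1) * (Gamma (\<alpha> * real k + 1) * Gamma \<alpha> / Gamma (\<alpha> * real k + 1 + \<alpha>))
      = G k * I k" for k
  proof -
    have "s powr (\<alpha> * real k + 1 + \<alpha> - 1) = s powr \<alpha> * (s powr \<alpha>) ^ k"
      using s by (simp add: powr_add powr_powr[symmetric] powr_realpow del: powr_powr)
    moreover have "\<alpha> * real k + 1 + \<alpha> = \<alpha> * real (Suc k) + 1" by (simp add: algebra_simps)
    ultimately show ?thesis by (simp only: I_def G_def) simp
  qed
  have g: "has_bochner_integral lborel (g k) ((- c) ^ k * I k)"
    and gn: "has_bochner_integral lborel (\<lambda>u. norm (g k u)) (c ^ k * I k)" for k
  proof -
    have *: "has_bochner_integral lborel (\<lambda>u. indicator {0<..<s} u *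
        (u powr ((\<alpha> * real k + 1) - 1) * (s - u) powr (\<alpha> - 1))) (G k * I k)"
      unfolding eq[symmetric] using \<alpha> s by (intro has_bochner_integral_Beta_scaled) (auto intro: add_nonneg_pos)
    from has_bochner_integral_mult_right[OF *, of "(- c) ^ k / G k"]
    show "has_bochner_integral lborel (g k) ((- c) ^ k * I k)"
      using Gpos[of k] unfolding g_def by simp
    from has_bochner_integral_mult_right[OF *, of "c ^ k / G k"]
    show "has_bochner_integral lborel (\<lambda>u. norm (g k u)) (c ^ k * I k)"
      using Gpos[of k] cpos unfolding g_def by (simp add: abs_mult power_abs)
  qed
  have gsum: "(\<lambda>k. g k u) sums (indicator {0<..<s} u * (AB_kernel \<alpha> u * (s - u) powr (\<alpha> - 1)))" for u
  proof (cases "u \<in> {0<..<s}")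
    case True
    have "g k u = (- c * u powr \<alpha>) ^ k / G k * (s - u) powr (\<alpha> - 1)" for k
      unfolding power_mult_distrib using True
      by (simp add: g_def powr_powr[symmetric] powr_realpow del: powr_powr)
    then show ?thesis
      using sums_mult2[OF Epow, of u "(s - u) powr (\<alpha> - 1)"] True by simp
  qed (simp add: g_def)
  \<comment> \<open>Needed at two points: z = - c gives the value of the integral, z = c the sum of
    the absolute values.\<close>
  have sumI: "(\<lambda>k. (z * s powr \<alpha>) ^ Suc k / G (Suc k)) sums (mittag_leffler \<alpha> (z * s powr \<alpha>) - 1)" for z :: real
  proof -
    define a where "a k = (z * s powr \<alpha>) ^ k / G k" for k
    have "a sums mittag_leffler \<alpha> (z * s powr \<alpha>)"
      using summable_sums[OF summable_mittag_leffler[OF \<alpha>(1), of "z * s powr \<alpha>"]]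
      by (simp add: a_def[abs_def] G_def mittag_leffler_def)
    moreover have "a 0 = 1" by (simp add: a_def G_def)
    ultimately have "(\<lambda>k. a (Suc k)) sums (mittag_leffler \<alpha> (z * s powr \<alpha>) - 1)"
      by (simp add: sums_Suc_iff)
    then show ?thesis by (simp only: a_def)
  qed
  have I_eq: "z ^ k * I k = Gamma \<alpha> / z * ((z * s powr \<alpha>) ^ Suc k / G (Suc k))" if "z \<noteq> 0" for k and z :: real
    using that by (simp add: I_def power_mult_distrib)
  \<comment> \<open>Sum and integral may be exchanged: the norms of the terms integrate to the
    series at + c, which converges as well.\<close>
  have "(\<lambda>k. integral\<^sup>L lborel (g k)) sums (\<integral>u. (\<Sum>k. g k u) \<partial>lborel)"
  proof (rule sums_integral)
    show "integrable lborel (g k)" for k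
      using g has_bochner_integral_iff by blast
    show "AE u in lborel. summable (\<lambda>k. norm (g k u))"
    proof (intro AE_I2)
      fix u
      have bound: "norm (norm (g k u)) \<le> (c * u powr \<alpha>) ^ k / G k * (s - u) powr (\<alpha> - 1)" for k
        unfolding power_mult_distrib using Gpos[of k] cpos
        by (cases "u \<in> {0<..<s}")
          (auto simp: g_def powr_powr[symmetric] powr_realpow abs_mult power_abs simp del: powr_powr)
      have "summable (\<lambda>k. (c * u powr \<alpha>) ^ k / G k * (s - u) powr (\<alpha> - 1))"
        using summable_mittag_leffler[OF \<alpha>(1)] unfolding G_def by (intro summable_mult2)
      then show "summable (\<lambda>k. norm (g k u))"
        using bound by (rule summable_comparison_test')
    qed
    have "(\<integral>u. norm (g k u) \<partial>lborel) = Gamma \<alpha> / c * ((c * s powr \<alpha>) ^ Suc k / G (Suc k))" for k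
      using has_bochner_integral_integral_eq[OF gn[of k]] I_eq[OF cpos[THEN less_imp_neq, symmetric], of k] by (rule trans)
    then show "summable (\<lambda>k. \<integral>u. norm (g k u) \<partial>lborel)"
      using summable_mult[OF sums_summable[OF sumI[of c]], of "Gamma \<alpha> / c"] by (simp only:)
  qed
  moreover have "(\<Sum>k. g k u) = indicator {0<..<s} u * (AB_kernel \<alpha> u * (s - u) powr (\<alpha> - 1))" for u
    using gsum[of u] by (rule sums_unique[symmetric])
  moreover have "integral\<^sup>L lborel (g k) = Gamma \<alpha> / (- c) * ((- c * s powr \<alpha>) ^ Suc k / G (Suc k))" for k
    using has_bochner_integral_integral_eq[OF g[of k]] I_eq[of "- c" k] cpos by force
  moreover have "(\<lambda>k. Gamma \<alpha> / (- c) * ((- c * s powr \<alpha>) ^ Suc k / G (Suc k))) sums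
      (Gamma \<alpha> / (- c) * (AB_kernel \<alpha> s - 1))"
  proof -
    have "mittag_leffler \<alpha> (- c * s powr \<alpha>) = AB_kernel \<alpha> s"
      by (simp add: AB_kernel_def c_def)
    then show ?thesis
      using sums_mult[OF sumI[of "- c"], of "Gamma \<alpha> / (- c)"] by (simp only:)
  qed
  ultimately have "(\<integral>u. indicator {0<..<s} u * (AB_kernel \<alpha> u * (s - u) powr (\<alpha> - 1)) \<partial>lborel)
      = Gamma \<alpha> / (- c) * (AB_kernel \<alpha> s - 1)"
    by (simp only: sums_unique2)
  moreover have "\<alpha> / ((1 - \<alpha>) * Gamma \<alpha>) = c / Gamma \<alpha>"
    by (simp add: c_def)
  ultimately show ?thesis
    using cpos G0 by simp
qed

subsection \<open>Smooth steps and the fundamental theorem of calculus for weak derivatives\<close>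

text \<open>Smoothness of \<open>D 0\<close> with explicit witnesses for all derivatives, from which
  the iterated \<open>deriv\<close> in \<open>test_function\<close> can be read off.\<close>

definition derivative_tower :: "(nat \<Rightarrow> real \<Rightarrow> real) \<Rightarrow> bool" where
  "derivative_tower D \<longleftrightarrow> (\<forall>n x. (D n has_real_derivative D (Suc n) x) (at x))"

lemma derivative_tower_funpow:
  assumes "derivative_tower D"
  shows "(deriv ^^ n) (D 0) = D n"
proof (induction n)
  case (Suc n)
  have "(deriv ^^ Suc n) (D 0) = deriv (D n)"
    using Suc.IH by simp
  then show ?case
    using assms by (simp add: derivative_tower_def DERIV_imp_deriv fun_eq_iff)
qed simp

lemma derivative_tower_affine:
  assumes "derivative_tower D"
  shows "derivative_tower (\<lambda>n x. D n (c * x + d) * c ^ n)"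
  unfolding derivative_tower_def
proof (intro allI)
  fix n x
  have "(D n has_real_derivative D (Suc n) (c * x + d)) (at (c * x + d))"
    using assms by (simp add: derivative_tower_def)
  moreover have "((\<lambda>x. c * x + d) has_real_derivative c) (at x)"
    by (auto intro!: derivative_eq_intros)
  ultimately have "((\<lambda>x. D n (c * x + d)) has_real_derivative D (Suc n) (c * x + d) * c) (at x)"
    by (rule DERIV_chain2)
  from DERIV_cmult_right[OF this, of "c ^ n"]
  show "((\<lambda>x. D n (c * x + d) * c ^ n) has_real_derivative D (Suc n) (c * x + d) * c ^ Suc n) (at x)"
    by (simp add: ac_simps)
qed

lemma derivative_tower_diff:
  assumes "derivative_tower D" "derivative_tower E"
  shows "derivative_tower (\<lambda>n x. D n x - E n x)"
  using assms by (auto simp: derivative_tower_def intro!: derivative_intros)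

text \<open>With y = 1 / (x (1 - x)) this is P(x) y^n exp(- y) on (0,1). The family contains the
  standard bump (P = 1, n = 0) and is closed under differentiation.\<close>

definition bump :: "real poly \<Rightarrow> nat \<Rightarrow> real \<Rightarrow> real" where
  "bump P n x = (if 0 < x \<and> x < 1
     then poly P x * (inverse (x * (1 - x)) ^ n * exp (- inverse (x * (1 - x)))) else 0)"

text \<open>A single term of the exponential series is at most its sum.\<close>

lemma power_mult_exp_minus_le:
  fixes y :: real
  assumes "0 \<le> y"
  shows "y ^ n * exp (- y) \<le> fact n"
proof -
  have "y ^ n /\<^sub>R fact n \<le> exp y"
    using sum_le_suminf[OF sums_summable[OF exp_converges[of y]], of "{n}"] sums_unique[OF exp_converges[of y]] assms
    by auto
  then show ?thesis
    by (simp add: exp_minus field_simps)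
qed

text \<open>Quadratic vanishing at both endpoints is what makes \<open>bump\<close> differentiable there.\<close>

lemma bump_quadratic_bound:
  obtains C where "\<And>x. \<bar>bump P n x\<bar> \<le> C * x\<^sup>2" "\<And>x. \<bar>bump P n x\<bar> \<le> C * (x - 1)\<^sup>2"
proof -
  have "compact (poly P ` {0..1})"
    by (intro compact_continuous_image continuous_intros) auto
  then obtain K where K: "\<And>x. x \<in> {0..1} \<Longrightarrow> \<bar>poly P x\<bar> \<le> K"
    by (force dest!: compact_imp_bounded simp: bounded_iff)
  have K0: "0 \<le> K" using K[of 0] by simp
  \<comment> \<open>Used with d = x and with d = 1 - x; on (0,1) both dominate x (1 - x).\<close>
  have bound: "\<bar>bump P n x\<bar> \<le> K * fact (n + 2) * d\<^sup>2"
    if d: "0 < x \<Longrightarrow> x < 1 \<Longrightarrow> x * (1 - x) \<le> d" for x d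
  proof (cases "0 < x \<and> x < 1")
    case True
    define y where "y = inverse (x * (1 - x))"
    have y: "0 < y" using True by (simp add: y_def)
    \<comment> \<open>As y is the inverse of x (1 - x), two extra powers of y pay for the quadratic
      factor.\<close>
    have "y ^ n * exp (- y) = (y ^ (n + 2) * exp (- y)) * (x * (1 - x))\<^sup>2"
    proof -
      have "y * (x * (1 - x)) = 1" unfolding y_def using True by (intro left_inverse) auto
      then have "y\<^sup>2 * (x * (1 - x))\<^sup>2 = 1" by (metis power_mult_distrib power_one)
      then have "y ^ n * exp (- y) * (y\<^sup>2 * (x * (1 - x))\<^sup>2) = y ^ n * exp (- y)" by simp
      then show ?thesis by (simp only: power_add ac_simps)
    qed
    also have "\<dots> \<le> fact (n + 2) * d\<^sup>2"
      using True d y by (intro mult_mono power_mult_exp_minus_le power_mono) auto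
    finally have yn: "y ^ n * exp (- y) \<le> fact (n + 2) * d\<^sup>2" .
    have "\<bar>poly P x\<bar> * (y ^ n * exp (- y)) \<le> K * (fact (n + 2) * d\<^sup>2)"
      by (rule mult_mono) (use K[of x] True y K0 yn in auto)
    moreover have "bump P n x = poly P x * (y ^ n * exp (- y))"
      using True by (simp add: bump_def y_def)
    ultimately show ?thesis
      using y by (simp add: abs_mult mult.assoc)
  qed (use K0 in \<open>auto simp: bump_def\<close>)
  show thesis
  proof
    show "\<bar>bump P n x\<bar> \<le> K * fact (n + 2) * x\<^sup>2" for x
      by (rule bound) (simp add: mult_left_le)
    show "\<bar>bump P n x\<bar> \<le> K * fact (n + 2) * (x - 1)\<^sup>2" for x
      using bound[of x "1 - x"] by (simp add: power2_commute mult_left_le_one_le)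
  qed
qed

lemma has_derivative_0_of_quadratic_bound:
  fixes f :: "real \<Rightarrow> real"
  assumes "\<And>x. \<bar>f x\<bar> \<le> C * (x - a)\<^sup>2"
  shows "(f has_real_derivative 0) (at a)"
proof -
  have [simp]: "f a = 0" using assms[of a] by simp
  have "((\<lambda>x. C * \<bar>x - a\<bar>) \<longlongrightarrow> C * \<bar>a - a\<bar>) (at a)"
    by (intro tendsto_intros)
  then have lim: "((\<lambda>x. C * \<bar>x - a\<bar>) \<longlongrightarrow> 0) (at a)" by simp
  have "norm ((f x - f a) / (x - a)) \<le> C * \<bar>x - a\<bar>" for x
  proof (cases "x = a")
    case False
    then show ?thesis
      using assms[of x] by (simp add: divide_simps power2_eq_square abs_mult_self_eq mult.assoc flip: abs_mult)
  qed simp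
  then have "((\<lambda>x. (f x - f a) / (x - a)) \<longlongrightarrow> 0) (at a)"
    using lim by (intro Lim_null_comparison[OF _ lim] always_eventually) auto
  then show ?thesis
    by (simp add: has_field_derivative_iff)
qed

text \<open>Here \<open>[:0, 1, -1:]\<close> is q = x (1 - x) and \<open>[:1, -2:]\<close> is q'.
  Differentiating produces the powers n, n + 1 and n + 2 of 1/q; the factors q bring all terms to
  the power n + 2.\<close>

definition bump_deriv_poly :: "real poly \<Rightarrow> nat \<Rightarrow> real poly" where
  "bump_deriv_poly P n = pderiv P * [:0, 1, -1:]\<^sup>2 - smult (real n) (P * [:1, -2:] * [:0, 1, -1:]) + P * [:1, -2:]"

lemma bump_has_derivative:
  "(bump P n has_real_derivative bump (bump_deriv_poly P n) (n + 2) x) (at x)"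
proof -
  consider "x = 0 \<or> x = 1" | "x < 0" | "1 < x" | "0 < x" "x < 1" by linarith
  then show ?thesis
  proof cases
    case 1
    obtain C where "\<And>x. \<bar>bump P n x\<bar> \<le> C * x\<^sup>2" and "\<And>x. \<bar>bump P n x\<bar> \<le> C * (x - 1)\<^sup>2"
      using bump_quadratic_bound[of P n] by metis
    then have "(bump P n has_real_derivative 0) (at 0)" "(bump P n has_real_derivative 0) (at 1)"
      by (auto intro!: has_derivative_0_of_quadratic_bound[where C = C])
    then show ?thesis
      using 1 by (auto simp: bump_def)
  next
    case 2
    have "((\<lambda>_. 0) has_real_derivative 0) (at x)" by simp
    then have "(bump P n has_real_derivative 0) (at x)"
      by (rule has_field_derivative_transform_within_open[where S = "{..<0}"]) (use 2 in \<open>auto simp: bump_def\<close>)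
    then show ?thesis using 2 by (simp add: bump_def)
  next
    case 3
    have "((\<lambda>_. 0) has_real_derivative 0) (at x)" by simp
    then have "(bump P n has_real_derivative 0) (at x)"
      by (rule has_field_derivative_transform_within_open[where S = "{1<..}"]) (use 3 in \<open>auto simp: bump_def\<close>)
    then show ?thesis using 3 by (simp add: bump_def)
  next
    case 4
    define r where "r z = inverse (z * (1 - z))" for z :: real
    have r0: "r x \<noteq> 0" "x * (1 - x) * r x = 1" using 4 by (auto simp: r_def field_simps)
    have r: "(r has_real_derivative - (1 - 2 * x) * (r x)\<^sup>2) (at x)"
      unfolding r_def using 4 by (auto intro!: derivative_eq_intros simp: power2_eq_square field_simps)
    \<comment> \<open>For n = 0 the truncated exponent \<open>n - Suc 0\<close> is harmless because
      the factor \<open>real n\<close> vanishes.\<close>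
    have n: "real n * r x ^ (n - Suc 0) * (r x)\<^sup>2 = real n * r x ^ (n + 1)"
      by (cases n) (simp_all add: power2_eq_square)
    have "((\<lambda>z. poly P z * (r z ^ n * exp (- r z))) has_real_derivative
        poly (pderiv P) x * (r x ^ n * exp (- r x)) +
        poly P x * (- (1 - 2 * x) * (real n * r x ^ (n - Suc 0) * (r x)\<^sup>2) * exp (- r x) +
          r x ^ n * ((1 - 2 * x) * (r x)\<^sup>2 * exp (- r x)))) (at x)"
      by (rule derivative_eq_intros r refl poly_DERIV)+ (simp add: algebra_simps)
    \<comment> \<open>Factors x (1 - x) r(x) = 1 are inserted to reach the common power n + 2 of
      r.\<close>
    also have "poly (pderiv P) x * (r x ^ n * exp (- r x)) +
        poly P x * (- (1 - 2 * x) * (real n * r x ^ (n - Suc 0) * (r x)\<^sup>2) * exp (- r x) +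
          r x ^ n * ((1 - 2 * x) * (r x)\<^sup>2 * exp (- r x))) =
        (poly (pderiv P) x * (x * (1 - x) * r x)\<^sup>2 - real n * poly P x * (1 - 2 * x) * (x * (1 - x) * r x) * r x
          + poly P x * (1 - 2 * x) * (r x)\<^sup>2) * r x ^ n * exp (- r x)"
      unfolding n r0 by (simp add: algebra_simps)
    also have "\<dots> = bump (bump_deriv_poly P n) (n + 2) x"
    proof -
      have "bump (bump_deriv_poly P n) (n + 2) x = poly (bump_deriv_poly P n) x * (r x ^ (n + 2) * exp (- r x))"
        using 4 by (simp add: bump_def r_def)
      then show ?thesis
        by (simp add: bump_deriv_poly_def algebra_simps power2_eq_square)
    qed
    finally show ?thesis
      by (rule has_field_derivative_transform_within_open[where S = "{0<..<1}"])
        (use 4 in \<open>auto simp: bump_def r_def\<close>)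
  qed
qed

text \<open>The step is an antiderivative of the standard bump, normalized to rise from 0 to 1.
  Positivity of the bump inside (0,1) makes the normalizing constant nonzero.\<close>

lemma smooth_step_exists:
  obtains D where "derivative_tower D"
    "\<And>x. x \<le> 0 \<Longrightarrow> D 0 x = 0" "\<And>x. 1 \<le> x \<Longrightarrow> D 0 x = 1"
    "\<And>x. 0 \<le> D 0 x" "\<And>x. D 0 x \<le> 1"
    "\<And>x. x \<notin> {0<..<1} \<Longrightarrow> D 1 x = 0"
proof -
  \<comment> \<open>Tracks the polynomial and the exponent of the k-th derivative of the
    bump.\<close>
  define S where "S = rec_nat ([:1:], 0) (\<lambda>_ (P, n). (bump_deriv_poly P n, n + 2))"
  define T where "T k = (case S k of (P, n) \<Rightarrow> bump P n)" for k
  have T: "(T k has_real_derivative T (Suc k) x) (at x)" for k x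
    using bump_has_derivative by (auto simp: T_def S_def split: prod.splits)
  have T0: "T 0 = bump [:1:] 0" by (simp add: T_def S_def)
  have "isCont (T 0) x" for x
    using T DERIV_isCont by blast
  then obtain F where F: "\<And>x. (F has_real_derivative T 0 x) (at x)"
    using einterval_antiderivative[of "-\<infinity>" "\<infinity>" "T 0"]
    by (auto simp: has_real_derivative_iff_has_vector_derivative)
  have mvt: "\<exists>z. x < z \<and> z < y \<and> F y - F x = (y - x) * T 0 z" if "x < y" for x y
    using MVT2[OF that, of F "T 0"] F by blast
  have T0_nonneg: "0 \<le> T 0 x" and T0_pos: "0 < x \<Longrightarrow> x < 1 \<Longrightarrow> 0 < T 0 x"
    and T0_zero: "x \<notin> {0<..<1} \<Longrightarrow> T 0 x = 0" for x
    by (auto simp: T0 bump_def)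
  have Fmono: "F x \<le> F y" if "x \<le> y" for x y
  proof (cases "x = y")
    case False
    then have "x < y" using that by simp
    then obtain z where "F y - F x = (y - x) * T 0 z" using mvt by blast
    moreover have "0 \<le> (y - x) * T 0 z" using that T0_nonneg by simp
    ultimately show ?thesis by simp
  qed simp
  have Fpos: "F 0 < F 1"
    using mvt[of 0 1] T0_pos by force
  have F0: "F x = F 0" if "x \<le> 0" for x
    using mvt[of x 0] that T0_zero by (cases "x = 0") force+
  have F1: "F x = F 1" if "1 \<le> x" for x
    using mvt[of 1 x] that T0_zero by (cases "x = 1") force+
  \<comment> \<open>The index is shifted by one: level 0 is the antiderivative, level j + 1 the j-th
    derivative of the bump.\<close>
  define D where "D k x = (case k of 0 \<Rightarrow> (F x - F 0) / (F 1 - F 0) | Suc j \<Rightarrow> T j x / (F 1 - F 0))" for k x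
  show thesis
  proof
    show "derivative_tower D"
      unfolding derivative_tower_def
    proof (intro allI)
      fix n x
      have "((\<lambda>x. (F x - F 0) / (F 1 - F 0)) has_real_derivative T 0 x / (F 1 - F 0)) (at x)"
        "((\<lambda>x. T j x / (F 1 - F 0)) has_real_derivative T (Suc j) x / (F 1 - F 0)) (at x)" for j
        using DERIV_cdivide[OF DERIV_diff[OF F[of x] DERIV_const[of "F 0"]], of "F 1 - F 0"]
          DERIV_cdivide[OF T[of j x], of "F 1 - F 0"] by simp_all
      then show "(D n has_real_derivative D (Suc n) x) (at x)"
        by (cases n) (simp_all add: D_def[abs_def])
    qed
    show "0 \<le> D 0 x" "D 0 x \<le> 1" for x
    proof -
      have "F 0 \<le> F x \<and> F x \<le> F 1"
        using Fmono[of 0 x] Fmono[of x 1] F0[of x] F1[of x] Fpos by linarith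
      then show "0 \<le> D 0 x" "D 0 x \<le> 1" using Fpos by (auto simp: D_def)
    qed
    show "D 0 x = 0" if "x \<le> 0" for x
      using F0[OF that] by (simp add: D_def)
    show "D 0 x = 1" if "1 \<le> x" for x
      using F1[OF that] Fpos by (simp add: D_def)
    show "D 1 x = 0" if "x \<notin> {0<..<1}" for x
      using T0_zero[OF that] by (simp add: D_def)
  qed
qed

text \<open>The test function is the difference of two steep smooth steps starting at s and at t.
  Its derivative is a unit mass concentrating at s minus one concentrating at t, so the weak
  identity tends to f(s) - f(t) = - \<integral> w over (s,t].\<close>

lemma weak_derivative_FTC:
  fixes f w :: "real \<Rightarrow> real"
  assumes weak: "has_weak_derivative_on f w {a<..<b}"
    and cont: "continuous_on {a<..<b} f"
    and st: "a < s" "s < t" "t < b"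
  shows "f t - f s = (LINT x:{s<..t}|lebesgue. w x)"
proof -
  obtain D where D: "derivative_tower D"
    and D0: "\<And>x. x \<le> 0 \<Longrightarrow> D 0 x = 0" "\<And>x. 1 \<le> x \<Longrightarrow> D 0 x = 1"
      "\<And>x. 0 \<le> D 0 x" "\<And>x. D 0 x \<le> 1"
    and D1: "\<And>x. x \<notin> {0<..<1} \<Longrightarrow> D 1 x = 0"
    using smooth_step_exists by blast
  have DD: "(D n has_real_derivative D (Suc n) x) (at x)" for n x
    using D by (simp add: derivative_tower_def)
  then have Dcont: "continuous_on A (D n)" for n A
    by (meson DERIV_isCont continuous_at_imp_continuous_on)
  have [measurable]: "D n \<in> borel_measurable borel" for n
    using Dcont by (rule borel_measurable_continuous_onI)
  \<comment> \<open>Half the distance from t to b. The steps rise to the right of s and t over a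
    length \<epsilon> n \<le> \<eta>, so all test functions are supported in one compact K inside
    (a,b).\<close>
  define \<eta> where "\<eta> = (b - t) / 2"
  have \<eta>: "0 < \<eta>" "t + \<eta> < b" using st by (auto simp: \<eta>_def field_simps)
  define \<epsilon> where "\<epsilon> n = \<eta> / real (Suc n)" for n
  have \<epsilon>: "0 < \<epsilon> n" "\<epsilon> n \<le> \<eta>" for n
    using \<eta> by (auto simp: \<epsilon>_def field_simps intro: order_trans[OF _ mult_left_mono])
  have \<epsilon>0: "\<epsilon> \<longlonglongrightarrow> 0"
    unfolding \<epsilon>_def by (rule LIMSEQ_Suc[OF lim_const_over_n])
  define K where "K = {s..t + \<eta>}"
  have K: "compact K" "K \<subseteq> {a<..<b}" using st \<eta> by (auto simp: K_def)
  define \<phi> where "\<phi> n x = D 0 ((x - s) / \<epsilon> n) - D 0 ((x - t) / \<epsilon> n)" for n x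
  define \<phi>' where "\<phi>' n x = D 1 ((x - s) / \<epsilon> n) / \<epsilon> n - D 1 ((x - t) / \<epsilon> n) / \<epsilon> n" for n x

  \<comment> \<open>The approximating test functions\<close>
  have \<phi>_tower: "derivative_tower (\<lambda>m x. D m ((x - s) / \<epsilon> n) * (1 / \<epsilon> n) ^ m - D m ((x - t) / \<epsilon> n) * (1 / \<epsilon> n) ^ m)"
    for n
    using derivative_tower_diff[OF derivative_tower_affine[OF D, of "1 / \<epsilon> n" "- s / \<epsilon> n"]
        derivative_tower_affine[OF D, of "1 / \<epsilon> n" "- t / \<epsilon> n"]]
    by (simp add: diff_divide_distrib)
  have \<phi>_supp: "\<phi> n x = 0" if "x \<notin> K" for n x
  proof (cases "x < s")
    case True
    then show ?thesis using st \<epsilon>[of n] by (simp add: \<phi>_def D0 divide_nonpos_pos)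
  next
    case False
    then have "t + \<epsilon> n \<le> x" using that \<epsilon>(2)[of n] by (auto simp: K_def)
    then show ?thesis using st \<epsilon>(1)[of n] by (simp add: \<phi>_def D0 le_divide_eq)
  qed
  have test: "test_function {a<..<b} (\<phi> n)" and deriv: "deriv (\<phi> n) = \<phi>' n" for n
  proof -
    let ?E = "\<lambda>m x. D m ((x - s) / \<epsilon> n) * (1 / \<epsilon> n) ^ m - D m ((x - t) / \<epsilon> n) * (1 / \<epsilon> n) ^ m"
    have E: "?E 0 = \<phi> n" "?E 1 = \<phi>' n" by (auto simp: \<phi>_def \<phi>'_def)
    have funpow: "(deriv ^^ m) (\<phi> n) = ?E m" for m
      unfolding E(1)[symmetric] by (rule derivative_tower_funpow[OF \<phi>_tower])
    have "(deriv ^^ m) (\<phi> n) differentiable at x" for m x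
      using \<phi>_tower[of n] unfolding funpow derivative_tower_def real_differentiable_def by blast
    moreover have "closure {x. \<phi> n x \<noteq> 0} \<subseteq> K"
      using \<phi>_supp K by (intro closure_minimal compact_imp_closed) auto
    moreover have "bounded {x. \<phi> n x \<noteq> 0}"
      by (rule bounded_subset[OF compact_imp_bounded[OF K(1)]]) (use \<phi>_supp in auto)
    ultimately show "test_function {a<..<b} (\<phi> n)"
      using K by (auto simp: test_function_def)
    show "deriv (\<phi> n) = \<phi>' n"
      using funpow[of 1] E(2) by simp
  qed

  \<comment> \<open>Cutting f off to K gives a bounded Borel function on the whole line; continuity
    of f is only known on (a,b).\<close>
  define F where "F x = indicator K x * f x" for x
  have [measurable]: "F \<in> borel_measurable borel"
    using borel_measurable_continuous_on_indicator[of K f] K continuous_on_subset[OF cont K(2)]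
    by (simp add: F_def[abs_def] K_def)
  have "compact (f ` K)"
    by (intro compact_continuous_image K continuous_on_subset[OF cont K(2)])
  then obtain M where M: "\<And>x. x \<in> K \<Longrightarrow> \<bar>f x\<bar> \<le> M"
    by (force dest!: compact_imp_bounded simp: bounded_iff)
  then have FM: "\<bar>F x\<bar> \<le> \<bar>M\<bar>" for x
    by (force simp: F_def indicator_def)
  have D1_int: "has_bochner_integral lborel (D 1) 1"
  proof -
    have "has_bochner_integral lborel (\<lambda>x. D 1 x * indicator {0..1} x) (D 0 1 - D 0 0)"
      using DD[of 0] DD[of 1] by (intro has_bochner_integral_FTC_Icc_real) (auto intro: DERIV_isCont)
    moreover have "D 1 x * indicator {0..1} x = D 1 x" for x
      using D1[of x] by (cases "x \<in> {0<..<1}") auto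
    moreover have "D 0 1 - D 0 0 = 1" by (simp add: D0)
    ultimately show ?thesis by (simp only:)
  qed
  \<comment> \<open>Substitution x = p + \<epsilon> n y turns the concentrating masses into a fixed
    density \<open>D 1\<close> of total mass 1, which suits dominated convergence.\<close>
  have piece: "integrable lborel (\<lambda>x. F x * (D 1 ((x - p) / \<epsilon> n) / \<epsilon> n))"
    "(\<integral>x. F x * (D 1 ((x - p) / \<epsilon> n) / \<epsilon> n) \<partial>lborel) = (\<integral>y. F (p + \<epsilon> n * y) * D 1 y \<partial>lborel)" for p n
  proof -
    have "integrable lborel (\<lambda>y. F (p + \<epsilon> n * y) * D 1 y / \<epsilon> n)"
    proof (rule Bochner_Integration.integrable_bound)
      show "integrable lborel (\<lambda>y. \<bar>M\<bar> * D 1 y / \<epsilon> n)"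
        using D1_int by (auto simp: has_bochner_integral_iff)
      show "AE y in lborel. norm (F (p + \<epsilon> n * y) * D 1 y / \<epsilon> n) \<le> norm (\<bar>M\<bar> * D 1 y / \<epsilon> n)"
        using FM \<epsilon>(1)[of n] by (intro AE_I2) (auto simp: abs_mult intro!: divide_right_mono mult_right_mono)
    qed simp
    then show "integrable lborel (\<lambda>x. F x * (D 1 ((x - p) / \<epsilon> n) / \<epsilon> n))"
      using \<epsilon>(1)[of n] by (subst lborel_integrable_real_affine_iff[of "\<epsilon> n" _ p, symmetric]) auto
    show "(\<integral>x. F x * (D 1 ((x - p) / \<epsilon> n) / \<epsilon> n) \<partial>lborel) = (\<integral>y. F (p + \<epsilon> n * y) * D 1 y \<partial>lborel)"
      using \<epsilon>(1)[of n] by (subst lborel_integral_real_affine[of "\<epsilon> n" _ p]) auto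
  qed
  have piece_lim: "(\<lambda>n. \<integral>x. F x * (D 1 ((x - p) / \<epsilon> n) / \<epsilon> n) \<partial>lborel) \<longlonglongrightarrow> f p"
    if p: "s \<le> p" "p \<le> t" for p
  proof -
    have "(\<lambda>n. \<integral>y. F (p + \<epsilon> n * y) * D 1 y \<partial>lborel) \<longlonglongrightarrow> (\<integral>y. f p * D 1 y \<partial>lborel)"
    proof (rule integral_dominated_convergence[where w = "\<lambda>y. \<bar>M\<bar> * \<bar>D 1 y\<bar>"])
      show "integrable lborel (\<lambda>y. \<bar>M\<bar> * \<bar>D 1 y\<bar>)"
        using D1_int by (auto simp: has_bochner_integral_iff)
      show "AE y in lborel. norm (F (p + \<epsilon> n * y) * D 1 y) \<le> \<bar>M\<bar> * \<bar>D 1 y\<bar>" for n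
        using FM by (intro AE_I2) (auto simp: abs_mult intro!: mult_right_mono)
      show "AE y in lborel. (\<lambda>n. F (p + \<epsilon> n * y) * D 1 y) \<longlonglongrightarrow> f p * D 1 y"
      proof (intro AE_I2)
        fix y :: real
        show "(\<lambda>n. F (p + \<epsilon> n * y) * D 1 y) \<longlonglongrightarrow> f p * D 1 y"
        \<comment> \<open>Only 0 < y < 1 matters, and for such y the point p + \<epsilon> n y lies
          in K, to the right of p.\<close>
        proof (cases "y \<in> {0<..<1}")
          case True
          have "\<epsilon> n * y \<le> \<epsilon> n * 1" for n
            using True \<epsilon>(1)[of n] by (intro mult_left_mono) auto
          then have le: "\<epsilon> n * y \<le> \<eta>" for n
            using \<epsilon>(2)[of n] by (metis mult.right_neutral order_trans)
          have "0 \<le> \<epsilon> n * y" for n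
            using True \<epsilon>(1)[of n] by simp
          then have "p + \<epsilon> n * y \<in> K" for n
            using add_mono[OF p(1), of 0 "\<epsilon> n * y"] add_mono[OF p(2) le[of n]] by (simp add: K_def)
          then have "F (p + \<epsilon> n * y) = f (p + \<epsilon> n * y)" for n
            by (simp add: F_def)
          moreover have "(\<lambda>n. f (p + \<epsilon> n * y)) \<longlonglongrightarrow> f p"
          proof (rule isCont_tendsto_compose[of p f])
            show "isCont f p"
              using cont p st by (auto simp: continuous_on_eq_continuous_at)
            show "(\<lambda>n. p + \<epsilon> n * y) \<longlonglongrightarrow> p"
              using tendsto_add[OF tendsto_const tendsto_mult_left_zero[OF \<epsilon>0], of p y] by simp
          qed
          ultimately show ?thesis by (auto intro!: tendsto_intros)
        next
          case False
          then have "D 1 y = 0" by (rule D1)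
          then show ?thesis by (simp only: mult_zero_right tendsto_const)
        qed
      qed
    qed auto
    then show ?thesis
      unfolding piece(2) using D1_int by (simp add: has_bochner_integral_iff)
  qed
  have L: "(LINT x:{a<..<b}|lebesgue. f x * deriv (\<phi> n) x) =
      (\<integral>x. F x * (D 1 ((x - s) / \<epsilon> n) / \<epsilon> n) \<partial>lborel) - (\<integral>x. F x * (D 1 ((x - t) / \<epsilon> n) / \<epsilon> n) \<partial>lborel)" for n
  proof -
    have \<phi>'0: "\<phi>' n x = 0" if "x \<notin> K" for x
    proof -
      have "(x - s) / \<epsilon> n \<notin> {0<..<1} \<and> (x - t) / \<epsilon> n \<notin> {0<..<1}"
        using that st \<epsilon>[of n] by (auto simp: K_def zero_less_divide_iff divide_less_eq_1)
      then have "D 1 ((x - s) / \<epsilon> n) = 0 \<and> D 1 ((x - t) / \<epsilon> n) = 0"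
        using D1 by blast
      then show ?thesis by (simp only: \<phi>'_def div_0 diff_self)
    qed
    have "(LINT x:{a<..<b}|lebesgue. f x * deriv (\<phi> n) x) =
        (\<integral>x. F x * (D 1 ((x - s) / \<epsilon> n) / \<epsilon> n) - F x * (D 1 ((x - t) / \<epsilon> n) / \<epsilon> n) \<partial>lebesgue)"
      unfolding set_lebesgue_integral_def
    proof (rule Bochner_Integration.integral_cong[OF refl])
      fix x
      have "indicator {a<..<b} x *\<^sub>R (f x * deriv (\<phi> n) x) = F x * \<phi>' n x"
        using K(2) \<phi>'0[of x] by (cases "x \<in> K") (auto simp: F_def deriv)
      then show "indicator {a<..<b} x *\<^sub>R (f x * deriv (\<phi> n) x) =
          F x * (D 1 ((x - s) / \<epsilon> n) / \<epsilon> n) - F x * (D 1 ((x - t) / \<epsilon> n) / \<epsilon> n)"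
        by (simp add: \<phi>'_def right_diff_distrib)
    qed
    also have "\<dots> = (\<integral>x. F x * (D 1 ((x - s) / \<epsilon> n) / \<epsilon> n) - F x * (D 1 ((x - t) / \<epsilon> n) / \<epsilon> n) \<partial>lborel)"
      by (rule integral_completion) measurable
    also have "\<dots> = (\<integral>x. F x * (D 1 ((x - s) / \<epsilon> n) / \<epsilon> n) \<partial>lborel) - (\<integral>x. F x * (D 1 ((x - t) / \<epsilon> n) / \<epsilon> n) \<partial>lborel)"
      by (rule Bochner_Integration.integral_diff[OF piece(1) piece(1)])
    finally show ?thesis .
  qed
  have lim1: "(\<lambda>n. LINT x:{a<..<b}|lebesgue. f x * deriv (\<phi> n) x) \<longlonglongrightarrow> f s - f t"
    unfolding L using st by (intro tendsto_diff piece_lim) auto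

  \<comment> \<open>Limit of the side containing the weak derivative\<close>
  define W where "W x = indicator K x * w x" for x
  have W: "integrable lebesgue W"
    using weak K by (auto simp: has_weak_derivative_on_def locally_integrable_on_def set_integrable_def W_def[abs_def])
  \<comment> \<open>At x = p every step has the value \<open>D 0 0 = 0\<close>, so the limit
    excludes p; this is why the interval (s,t] is half-open.\<close>
  have step_lim: "(\<lambda>n. D 0 ((x - p) / \<epsilon> n)) \<longlonglongrightarrow> indicator {p<..} x" for x p
  proof (cases "p < x")
    case True
    then have "eventually (\<lambda>n. \<epsilon> n < x - p) sequentially"
      using order_tendstoD(2)[OF \<epsilon>0, of "x - p"] by simp
    then have "eventually (\<lambda>n. D 0 ((x - p) / \<epsilon> n) = 1) sequentially"
      by eventually_elim (use \<epsilon>(1) in \<open>auto intro!: D0 simp: le_divide_eq\<close>)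
    then show ?thesis
      using True by (auto intro: tendsto_eventually)
  next
    case False
    then have "D 0 ((x - p) / \<epsilon> n) = 0" for n
      using \<epsilon>(1)[of n] by (intro D0) (auto simp: divide_nonpos_pos)
    then show ?thesis using False by simp
  qed
  have "(\<lambda>n. \<integral>x. W x * \<phi> n x \<partial>lebesgue) \<longlonglongrightarrow> (\<integral>x. W x * indicator {s<..t} x \<partial>lebesgue)"
  proof (rule integral_dominated_convergence[where w = "\<lambda>x. \<bar>W x\<bar>"])
    have [measurable]: "W \<in> borel_measurable lebesgue"
      using W by auto
    have [measurable]: "\<phi> n \<in> borel_measurable lebesgue" for n
      by (rule measurable_completion) (simp add: \<phi>_def[abs_def])
    show "(\<lambda>x. W x * \<phi> n x) \<in> borel_measurable lebesgue" for n
      by measurable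
    show "(\<lambda>x. W x * indicator {s<..t} x) \<in> borel_measurable lebesgue"
      by (intro borel_measurable_times borel_measurable_indicator) auto
    show "AE x in lebesgue. norm (W x * \<phi> n x) \<le> \<bar>W x\<bar>" for n
    proof (intro AE_I2)
      fix x
      have "\<bar>\<phi> n x\<bar> \<le> 1"
        using D0(3,4)[of "(x - s) / \<epsilon> n"] D0(3,4)[of "(x - t) / \<epsilon> n"] by (simp add: \<phi>_def)
      then show "norm (W x * \<phi> n x) \<le> \<bar>W x\<bar>"
        by (simp add: abs_mult mult_left_le)
    qed
    show "AE x in lebesgue. (\<lambda>n. W x * \<phi> n x) \<longlonglongrightarrow> W x * indicator {s<..t} x"
    proof (intro AE_I2 tendsto_mult tendsto_const)
      fix x
      have "indicator {s<..} x - indicator {t<..} x = (indicator {s<..t} x :: real)"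
        using st by (auto simp: indicator_def)
      then show "(\<lambda>n. \<phi> n x) \<longlonglongrightarrow> indicator {s<..t} x"
        unfolding \<phi>_def using tendsto_diff[OF step_lim[of x s] step_lim[of x t]] by simp
    qed
  qed (use W in auto)
  moreover have "(\<integral>x. W x * \<phi> n x \<partial>lebesgue) = (LINT x:{a<..<b}|lebesgue. w x * \<phi> n x)" for n
    unfolding set_lebesgue_integral_def
  proof (rule Bochner_Integration.integral_cong[OF refl])
    fix x
    show "W x * \<phi> n x = indicator {a<..<b} x *\<^sub>R (w x * \<phi> n x)"
      using K(2) \<phi>_supp[of x n] by (cases "x \<in> K") (auto simp: W_def)
  qed
  moreover have "(\<integral>x. W x * indicator {s<..t} x \<partial>lebesgue) = (LINT x:{s<..t}|lebesgue. w x)"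
    unfolding set_lebesgue_integral_def
    using \<eta> by (intro Bochner_Integration.integral_cong[OF refl]) (auto simp: W_def K_def indicator_def)
  moreover have "(LINT x:{a<..<b}|lebesgue. f x * deriv (\<phi> n) x) = - (LINT x:{a<..<b}|lebesgue. w x * \<phi> n x)" for n
    using weak test by (auto simp: has_weak_derivative_on_def)
  ultimately have "(\<lambda>n. LINT x:{a<..<b}|lebesgue. f x * deriv (\<phi> n) x) \<longlonglongrightarrow> - (LINT x:{s<..t}|lebesgue. w x)"
    by (simp add: tendsto_minus)
  from LIMSEQ_unique[OF lim1 this] show ?thesis by simp
qed

subsection \<open>Convolution on the line\<close>

text \<open>Since k is bounded, W(x) k(y - x) p(t - y) is dominated on the plane by a multiple of
  the integrable product W(x) p(t - y). Fubini applies, and y = x + u gives the right-hand side. The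
  factor p may be unbounded, as the fractional kernel is near 0.\<close>

lemma
  fixes W k p :: "real \<Rightarrow> real"
  assumes W: "integrable lborel W" and p: "integrable lborel p"
    and k: "k \<in> borel_measurable borel" "\<And>x. \<bar>k x\<bar> \<le> C"
  shows integrable_convolution_convolution:
      "integrable lborel (\<lambda>y. (\<integral>x. W x * k (y - x) \<partial>lborel) * p (t - y))"
    and convolution_assoc:
      "(\<integral>y. (\<integral>x. W x * k (y - x) \<partial>lborel) * p (t - y) \<partial>lborel) =
       (\<integral>x. W x * (\<integral>u. k u * p (t - x - u) \<partial>lborel) \<partial>lborel)"
proof -
  have [measurable]: "W \<in> borel_measurable borel" "p \<in> borel_measurable borel" "k \<in> borel_measurable borel"
    using W p k by auto
  have C0: "0 \<le> C" using k(2)[of 0] by simp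
  have p': "integrable lborel (\<lambda>y. p (t - y))"
    using lborel_integrable_real_affine[OF p, of "-1" t] by simp
  have "integrable (lborel \<Otimes>\<^sub>M lborel) (\<lambda>(x, y). W x * p (t - y))"
  proof (rule lborel_pair.Fubini_integrable)
    show "integrable lborel (\<lambda>x. \<integral>y. norm (case (x, y) of (x, y) \<Rightarrow> W x * p (t - y)) \<partial>lborel)"
      using W p' by (simp add: abs_mult)
    show "AE x in lborel. integrable lborel (\<lambda>y. case (x, y) of (x, y) \<Rightarrow> W x * p (t - y))"
      using p' by simp
  qed measurable
  then have bound: "integrable (lborel \<Otimes>\<^sub>M lborel) (\<lambda>z. C * (case z of (x, y) \<Rightarrow> W x * p (t - y)))"
    by (rule integrable_mult_right)
  have H: "integrable (lborel \<Otimes>\<^sub>M lborel) (\<lambda>(x, y). W x * k (y - x) * p (t - y))"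
  proof (rule Bochner_Integration.integrable_bound[OF bound])
    show "AE z in lborel \<Otimes>\<^sub>M lborel. norm (case z of (x, y) \<Rightarrow> W x * k (y - x) * p (t - y)) \<le>
        norm (C * (case z of (x, y) \<Rightarrow> W x * p (t - y)))"
    proof (intro AE_I2, clarify)
      fix x y
      have "\<bar>k (y - x)\<bar> * \<bar>W x * p (t - y)\<bar> \<le> C * \<bar>W x * p (t - y)\<bar>"
        using k(2) by (rule mult_right_mono) simp
      then show "norm (W x * k (y - x) * p (t - y)) \<le> norm (C * (W x * p (t - y)))"
        using C0 by (simp add: abs_mult ac_simps)
    qed
  qed measurable
  from lborel_pair.integrable_snd[OF H]
  show "integrable lborel (\<lambda>y. (\<integral>x. W x * k (y - x) \<partial>lborel) * p (t - y))"
    by simp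
  have "(\<integral>y. (\<integral>x. W x * k (y - x) \<partial>lborel) * p (t - y) \<partial>lborel) =
      (\<integral>x. (\<integral>y. W x * k (y - x) * p (t - y) \<partial>lborel) \<partial>lborel)"
    using lborel_pair.Fubini_integral[OF H] by simp
  also have "\<dots> = (\<integral>x. W x * (\<integral>y. k (y - x) * p (t - y) \<partial>lborel) \<partial>lborel)"
    by (simp add: mult.assoc)
  also have "\<dots> = (\<integral>x. W x * (\<integral>u. k u * p (t - x - u) \<partial>lborel) \<partial>lborel)"
    using lborel_integral_real_affine[of 1 "\<lambda>y. k (y - x) * p (t - y)" x for x]
    by (simp add: diff_diff_eq)
  finally show "(\<integral>y. (\<integral>x. W x * k (y - x) \<partial>lborel) * p (t - y) \<partial>lborel) =
       (\<integral>x. W x * (\<integral>u. k u * p (t - x - u) \<partial>lborel) \<partial>lborel)" .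
qed

lemma integrable_convolution_bounded:
  fixes W k :: "real \<Rightarrow> real"
  assumes W: "integrable lborel W"
    and k: "k \<in> borel_measurable borel" "\<And>x. \<bar>k x\<bar> \<le> C"
  shows "integrable lborel (\<lambda>x. W x * k (y - x))"
proof (rule Bochner_Integration.integrable_bound[of _ "\<lambda>x. C * W x"])
  have [measurable]: "W \<in> borel_measurable borel" "k \<in> borel_measurable borel"
    using W k by auto
  show "(\<lambda>x. W x * k (y - x)) \<in> borel_measurable lborel" by measurable
  have "0 \<le> C" using k(2)[of 0] by simp
  moreover have "\<bar>k (y - x)\<bar> * \<bar>W x\<bar> \<le> C * \<bar>W x\<bar>" for x
    using k(2) by (rule mult_right_mono) simp
  ultimately show "AE x in lborel. norm (W x * k (y - x)) \<le> norm (C * W x)"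
    by (intro AE_I2) (simp add: abs_mult mult.commute)
qed (use W in simp)

text \<open>For fixed y the bad points x are a reflected copy of X, hence a null set, and C |W|
  dominates. Jumps of a truncated kernel thus do not destroy continuity of the convolution.\<close>

lemma isCont_convolution:
  fixes W k :: "real \<Rightarrow> real"
  assumes W: "integrable lborel W"
    and k: "k \<in> borel_measurable borel" "\<And>x. \<bar>k x\<bar> \<le> C"
    and X: "countable X" "\<And>x. x \<notin> X \<Longrightarrow> isCont k x"
  shows "isCont (\<lambda>y. \<integral>x. W x * k (y - x) \<partial>lborel) y"
proof (rule continuous_at_sequentiallyI)
  fix Y :: "nat \<Rightarrow> real" assume Y: "Y \<longlonglongrightarrow> y"
  have [measurable]: "W \<in> borel_measurable borel" "k \<in> borel_measurable borel"
    using W k by auto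
  show "(\<lambda>n. \<integral>x. W x * k (Y n - x) \<partial>lborel) \<longlonglongrightarrow> (\<integral>x. W x * k (y - x) \<partial>lborel)"
  proof (rule integral_dominated_convergence[where w = "\<lambda>x. C * \<bar>W x\<bar>"])
    have "\<bar>k z\<bar> * \<bar>W x\<bar> \<le> C * \<bar>W x\<bar>" for x z
      using k(2) by (rule mult_right_mono) simp
    then show "AE x in lborel. norm (W x * k (Y n - x)) \<le> C * \<bar>W x\<bar>" for n
      by (intro AE_I2) (simp add: abs_mult mult.commute)
    have "(\<lambda>z. y - z) ` X \<in> null_sets lborel"
      using X by (intro countable_imp_null_set_lborel countable_image)
    then have "AE x in lborel. x \<notin> (\<lambda>z. y - z) ` X"
      by (rule AE_not_in)
    then show "AE x in lborel. (\<lambda>n. W x * k (Y n - x)) \<longlonglongrightarrow> W x * k (y - x)"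
    proof eventually_elim
      case (elim x)
      then have "y - x \<notin> X" by (metis diff_diff_eq2 add_diff_cancel_left' diff_add_cancel image_eqI)
      moreover have "(\<lambda>n. Y n - x) \<longlonglongrightarrow> y - x"
        by (intro tendsto_diff Y tendsto_const)
      ultimately show ?case
        by (intro tendsto_mult tendsto_const isCont_tendsto_compose[OF X(2)])
    qed
  qed (use W in auto)
qed

subsection \<open>Inversion of the fractional derivatives\<close>

lemma AB_kernel_bounded:
  assumes "0 < \<alpha>"
  obtains C where "0 \<le> C" "\<And>x. x \<in> {0..T} \<Longrightarrow> \<bar>AB_kernel \<alpha> x\<bar> \<le> C"
proof -
  have "compact (AB_kernel \<alpha> ` {0..T})"
    by (intro compact_continuous_image continuous_on_subset[OF continuous_on_AB_kernel[OF assms]]) auto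
  then obtain C where C: "\<forall>x\<in>{0..T}. \<bar>AB_kernel \<alpha> x\<bar> \<le> C"
    by (force dest!: compact_imp_bounded simp: bounded_iff)
  then have "\<bar>AB_kernel \<alpha> x\<bar> \<le> \<bar>C\<bar>" if "x \<in> {0..T}" for x
    using that by force
  then show thesis
    using that[of "\<bar>C\<bar>"] by simp
qed

text \<open>V is the fractional derivative stripped of its constant, which cancels against the one
  of the integral. The point t itself is included in the condition on g because \<open>g t\<close>
  occurs outside the integral.\<close>

lemma AB_integral_eqI:
  fixes B g V :: "real \<Rightarrow> real"
  assumes \<alpha>: "0 < \<alpha>" "\<alpha> < 1" and B: "B \<alpha> \<noteq> 0" and t: "0 < t"
    and g: "\<And>y. y \<in> {0<..t} \<Longrightarrow> g y = B \<alpha> / (1 - \<alpha>) * V y"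
    and int: "integrable lborel (\<lambda>y. indicator {0<..<t} y * (V y * (t - y) powr (\<alpha> - 1)))"
    and R: "V t + \<alpha> / ((1 - \<alpha>) * Gamma \<alpha>) *
      (\<integral>y. indicator {0<..<t} y * (V y * (t - y) powr (\<alpha> - 1)) \<partial>lborel) = R"
  shows "AB_integral_exists \<alpha> g t" "AB_integral B \<alpha> g t = R"
proof -
  let ?h = "\<lambda>y. indicator {0<..<t} y * (V y * (t - y) powr (\<alpha> - 1))"
  have *: "indicator {0<..<t} y *\<^sub>R (g y * (t - y) powr (\<alpha> - 1)) = B \<alpha> / (1 - \<alpha>) * ?h y" for y
    using g[of y] by (cases "y \<in> {0<..<t}") auto
  have h: "?h \<in> borel_measurable lborel"
    using int by (rule borel_measurable_integrable)
  have "integrable lebesgue (\<lambda>y. B \<alpha> / (1 - \<alpha>) * ?h y)"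
    by (intro integrable_mult_right) (simp add: integrable_completion[OF h] int)
  then show "AB_integral_exists \<alpha> g t"
    unfolding AB_integral_exists_def set_integrable_def * .
  have "(LINT y:{0<..<t}|lebesgue. g y * (t - y) powr (\<alpha> - 1)) = B \<alpha> / (1 - \<alpha>) * integral\<^sup>L lborel ?h"
    unfolding set_lebesgue_integral_def * integral_completion[OF h, symmetric] by (rule integral_mult_right_zero)
  then have "AB_integral B \<alpha> g t =
      V t + \<alpha> / ((1 - \<alpha>) * Gamma \<alpha>) * integral\<^sup>L lborel ?h"
    using B \<alpha> g[of t] t by (simp add: AB_integral_def)
  then show "AB_integral B \<alpha> g t = R"
    using R by simp
qed

text \<open>Membership in \<open>sobolev_H1\<close> supplies the witness for the choice. Only the
  defining property of a weak derivative is transferred; integrability up to 0 is obtained in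
  \<open>set_integrable_weak_derivative\<close>.\<close>

lemma has_weak_derivative_on_weak_derivative:
  assumes "f \<in> sobolev_H1 S"
  shows "has_weak_derivative_on f (weak_derivative S f) S"
  using assms unfolding sobolev_H1_def weak_derivative_def
  by (intro someI_ex[of "\<lambda>w. has_weak_derivative_on f w S"]) auto

text \<open>Near \<open>0\<close> the kernel stays away from \<open>0\<close>, so the existence of the Caputo derivative at one
  small point already forces the weak derivative to be integrable up to \<open>0\<close>.\<close>

lemma set_integrable_weak_derivative:
  assumes \<alpha>: "0 < \<alpha>" and T: "0 < T" "T < b"
    and f: "f \<in> sobolev_H1 {0<..<b}"
    and ABC: "\<forall>t\<in>{0<..<b}. ABC_exists \<alpha> b f t"
  shows "set_integrable lebesgue {0<..<T} (weak_derivative {0<..<b} f)"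
proof -
  define w where "w = weak_derivative {0<..<b} f"
  define E where "E = AB_kernel \<alpha>"
  have Econt: "continuous_on {0..} E" and E0: "E 0 = 1"
    using continuous_on_AB_kernel[OF \<alpha>] AB_kernel_0 by (simp_all add: E_def)
  then have "(E \<longlongrightarrow> 1) (at 0 within {0..})"
    by (metis atLeast_iff continuous_on_def order_refl)
  from order_tendstoD(1)[OF this, of "1/2"]
  obtain d where d: "0 < d" "\<And>x. x \<in> {0..} \<Longrightarrow> x \<noteq> 0 \<Longrightarrow> dist x 0 < d \<Longrightarrow> 1/2 < E x"
    by (auto simp: eventually_at)
  \<comment> \<open>\<delta> < d keeps the kernel above 1/2 on the whole interval, and \<delta> < T
    places \<delta> in (0,b), where the Caputo derivative exists.\<close>
  define \<delta> where "\<delta> = min (d / 2) (T / 2)"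
  have \<delta>: "0 < \<delta>" "\<delta> < d" "\<delta> < T" using d(1) T by (auto simp: \<delta>_def)
  have half: "1/2 < E (\<delta> - x)" if "x \<in> {0<..<\<delta>}" for x
    using d(2)[of "\<delta> - x"] that \<delta> by (auto simp: dist_real_def)
  let ?wE = "\<lambda>x. indicator {0<..<\<delta>} x *\<^sub>R (w x * E (\<delta> - x))"
  have wE: "integrable lebesgue ?wE"
    using ABC \<delta> T by (auto simp: ABC_exists_def set_integrable_def w_def E_def)
  have "continuous_on {0<..<\<delta>} (\<lambda>x. inverse (E (\<delta> - x)))"
    using half by (intro continuous_on_inverse continuous_on_compose2[OF Econt] continuous_intros) force+
  then have "(\<lambda>x. indicator {0<..<\<delta>} x *\<^sub>R inverse (E (\<delta> - x))) \<in> borel_measurable borel"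
    by (intro borel_measurable_continuous_on_indicator) auto
  then have m: "(\<lambda>x. indicator {0<..<\<delta>} x *\<^sub>R inverse (E (\<delta> - x))) \<in> borel_measurable lebesgue"
    by (intro measurable_completion) simp
  \<comment> \<open>Measurability of w on (0,\<delta>) is recovered by dividing the kernel out
    again.\<close>
  have w_eq: "indicator {0<..<\<delta>} x *\<^sub>R w x = ?wE x * (indicator {0<..<\<delta>} x *\<^sub>R inverse (E (\<delta> - x)))" for x
    using half[of x] by (cases "x \<in> {0<..<\<delta>}") auto
  have near: "set_integrable lebesgue {0<..<\<delta>} w"
    unfolding set_integrable_def
  proof (rule Bochner_Integration.integrable_bound[OF integrable_mult_right[OF wE, of 2]])
    show "(\<lambda>x. indicator {0<..<\<delta>} x *\<^sub>R w x) \<in> borel_measurable lebesgue"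
      unfolding w_eq using wE m by (intro borel_measurable_times) auto
    show "AE x in lebesgue. norm (indicator {0<..<\<delta>} x *\<^sub>R w x) \<le> norm (2 * ?wE x)"
    proof (intro AE_I2)
      fix x
      have "\<bar>w x\<bar> * 1 \<le> \<bar>w x\<bar> * (2 * \<bar>E (\<delta> - x)\<bar>)" if "x \<in> {0<..<\<delta>}"
        using half[OF that] by (intro mult_left_mono) auto
      then show "norm (indicator {0<..<\<delta>} x *\<^sub>R w x) \<le> norm (2 * ?wE x)"
        by (cases "x \<in> {0<..<\<delta>}") (auto simp: abs_mult ac_simps)
    qed
  qed
  have "compact {\<delta>..T}" "{\<delta>..T} \<subseteq> {0<..<b}" using \<delta> T by auto
  then have "set_integrable lebesgue {\<delta>..T} w"
    using has_weak_derivative_on_weak_derivative[OF f]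
    unfolding has_weak_derivative_on_def locally_integrable_on_def w_def by blast
  with near have "set_integrable lebesgue ({0<..<\<delta>} \<union> {\<delta>..T}) w"
    by (rule set_integrable_Un) auto
  then show ?thesis
    unfolding w_def by (rule set_integrable_subset) (use \<delta> in auto)
qed

theorem theorem3p1:
  fixes B :: "real \<Rightarrow> real" and \<alpha> b :: real and f :: "real \<Rightarrow> real"
  assumes "0 < \<alpha>" and "\<alpha> < 1" and "0 < b"
    and "B \<alpha> \<noteq> 0"
    and "f \<in> sobolev_H1 {0<..<b}"
    and "continuous_on {0..b} f"
    and "\<forall>t\<in>{0<..<b}. ABR_exists \<alpha> f t"
    and "\<forall>t\<in>{0<..<b}. ABC_exists \<alpha> b f t"
  shows "\<forall>t\<in>{0<..<b}.
      AB_integral_exists \<alpha> (ABR_derivative B \<alpha> f) t \<and>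
      AB_integral B \<alpha> (ABR_derivative B \<alpha> f) t = f t \<and>
      AB_integral_exists \<alpha> (ABC_derivative B \<alpha> b f) t \<and>
      AB_integral B \<alpha> (ABC_derivative B \<alpha> b f) t = f t - f 0"
proof
  fix t assume t: "t \<in> {0<..<b}"
  note \<alpha> = assms(1,2)
  \<comment> \<open>A point strictly between t and b: w is integrable up to T, and cutting off at T
    changes nothing near t.\<close>
  define T where "T = (t + b) / 2"
  have T: "0 < T" "t < T" "T < b" "0 < t" using t by (auto simp: T_def)
  define w where "w = weak_derivative {0<..<b} f"
  define E where "E = AB_kernel \<alpha>"
  define c where "c = \<alpha> / ((1 - \<alpha>) * Gamma \<alpha>)"

  \<comment> \<open>A Borel representative of the weak derivative\<close>
  have w_int: "set_integrable lebesgue {0<..<T} w"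
    unfolding w_def by (rule set_integrable_weak_derivative[OF \<alpha>(1) T(1,3) assms(5,8)])
  \<comment> \<open>w is only Lebesgue measurable, while Fubini is applied on \<open>lborel\<close>.
    W is made to vanish at every point outside (0,T), so that it can be convolved on the
    line.\<close>
  obtain W where W: "integrable lborel W" and W0: "\<And>x. x \<notin> {0<..<T} \<Longrightarrow> W x = 0"
    and Ww: "AE x in lebesgue. x \<in> {0<..<T} \<longrightarrow> w x = W x"
  proof -
    have int: "integrable lebesgue (\<lambda>x. indicator {0<..<T} x *\<^sub>R w x)"
      using w_int by (simp add: set_integrable_def)
    then have "(\<lambda>x. indicator {0<..<T} x *\<^sub>R w x) \<in> borel_measurable lebesgue" by (rule borel_measurable_integrable)
    then obtain W' where W': "W' \<in> borel_measurable lborel"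
      and "AE x in lborel. indicator {0<..<T} x *\<^sub>R w x = W' x"
      by (auto dest: completion_ex_borel_measurable_real)
    then have AE: "AE x in lebesgue. indicator {0<..<T} x *\<^sub>R w x = W' x"
      by (intro AE_completion)
    have "integrable lebesgue (\<lambda>x. indicator {0<..<T} x *\<^sub>R w x) \<longleftrightarrow> integrable lebesgue W'"
      by (intro integrable_cong_AE AE borel_measurable_integrable int measurable_completion W')
    then have "integrable lborel W'"
      using int integrable_completion[OF W'] by simp
    then have "integrable lborel (\<lambda>x. indicator {0<..<T} x *\<^sub>R W' x)"
      by (intro integrable_mult_indicator) auto
    moreover have "AE x in lebesgue. x \<in> {0<..<T} \<longrightarrow> w x = indicator {0<..<T} x *\<^sub>R W' x"
      using AE by eventually_elim auto
    moreover have "indicator {0<..<T} x *\<^sub>R W' x = 0" if "x \<notin> {0<..<T}" for x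
      using that by simp
    ultimately show thesis
      using that by blast
  qed
  have [measurable]: "W \<in> borel_measurable borel" using W by auto

  \<comment> \<open>The truncated kernels\<close>
  define k where "k x = indicator {0..<T} x * E x" for x
  \<comment> \<open>Convolving with u is integration from 0, and with p the fractional integral
    without its constant. The cut at 0 confines the convolutions to the past, the cut at T makes the
    kernels integrable.\<close>
  define u where "u x = (indicator {0..<T} x :: real)" for x
  define p where "p x = indicator {0<..<T} x * x powr (\<alpha> - 1)" for x
  have Econt: "continuous_on {0..} E" and E0: "E 0 = 1"
    using continuous_on_AB_kernel[OF \<alpha>(1)] AB_kernel_0 by (simp_all add: E_def)
  obtain C where C0: "0 \<le> C" and C: "\<And>x. x \<in> {0..T} \<Longrightarrow> \<bar>E x\<bar> \<le> C"
    using AB_kernel_bounded[OF \<alpha>(1), of T] unfolding E_def by metis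
  have k_meas [measurable]: "k \<in> borel_measurable borel"
  proof -
    have "continuous_on {0..<T} E"
      by (rule continuous_on_subset[OF Econt]) auto
    then show ?thesis
      using borel_measurable_continuous_on_indicator[of "{0..<T}" E] by (simp add: k_def[abs_def])
  qed
  have u_meas [measurable]: "u \<in> borel_measurable borel" by (simp add: u_def[abs_def])
  have k_le: "\<bar>k x\<bar> \<le> C" for x
    using C[of x] C0 by (auto simp: k_def indicator_def)
  have u_le: "\<bar>u x\<bar> \<le> 1" for x by (auto simp: u_def indicator_def)
  have u_int: "integrable lborel u"
    unfolding u_def[abs_def] using T by (intro integrable_real_indicator) auto
  have k_int: "integrable lborel k"
  proof -
    have "set_integrable lborel {0..T} E"
      by (intro borel_integrable_atLeastAtMost' continuous_on_subset[OF Econt]) auto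
    then have "set_integrable lborel {0..<T} E"
      by (rule set_integrable_subset) auto
    then show ?thesis by (simp add: set_integrable_def k_def[abs_def])
  qed
  have p_int: "integrable lborel p"
  proof -
    \<comment> \<open>The Beta integral with second parameter 1, whose factor is 1 on (0,T).\<close>
    have "integrable lborel (\<lambda>x. indicator {0<..<T} x * (x powr (\<alpha> - 1) * (T - x) powr (1 - 1)))"
      using has_bochner_integral_Beta_scaled[of \<alpha> 1 T] \<alpha> T by (simp add: has_bochner_integral_iff)
    also have "(\<lambda>x. indicator {0<..<T} x * (x powr (\<alpha> - 1) * (T - x) powr (1 - 1))) = p"
      by (auto simp: p_def fun_eq_iff indicator_def)
    finally show ?thesis .
  qed
  \<comment> \<open>At 0 the kernel jumps from 0 to E(0) = 1, and at T it may jump back.\<close>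
  have k_cont: "isCont k x" if "x \<notin> {0, T}" for x
  proof (cases "x \<in> {0<..<T}")
    case True
    have "continuous_on {0<..<T} k \<longleftrightarrow> continuous_on {0<..<T} E"
      by (rule continuous_on_cong) (auto simp: k_def)
    moreover have "continuous_on {0<..<T} E"
      by (rule continuous_on_subset[OF Econt]) auto
    ultimately have "continuous_on {0<..<T} k" by simp
    then show ?thesis
      using True by (simp add: continuous_on_eq_continuous_at)
  next
    case False
    have "continuous_on ({..<0} \<union> {T<..}) k \<longleftrightarrow> continuous_on ({..<0} \<union> {T<..}) (\<lambda>_. 0 :: real)"
      using T by (intro continuous_on_cong) (auto simp: k_def)
    then show ?thesis
      using False that by (auto simp: continuous_on_eq_continuous_at open_Un)
  qed

  \<comment> \<open>Convolution of the weak derivative with the kernel\<close>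
  define V where "V y = (\<integral>x. W x * k (y - x) \<partial>lborel)" for y
  have V_cont: "isCont V y" for y
    unfolding V_def by (rule isCont_convolution[OF W k_meas k_le, where X = "{0, T}"]) (auto intro: k_cont)
  have V_neg: "V y = 0" if "y \<le> 0" for y
  proof -
    have "W x * k (y - x) = 0" for x
      using that W0[of x] by (cases "x \<in> {0<..<T}") (auto simp: k_def)
    then show ?thesis by (simp only: V_def integral_zero)
  qed

  \<comment> \<open>Recovering f from its weak derivative\<close>
  have f_eq: "f x = f 0 + (\<integral>y. W y * u (x - y) \<partial>lborel)" if x: "x \<in> {0<..<T}" for x
  proof -
    \<comment> \<open>The fundamental theorem holds strictly inside (0,b), so 0 is approached by
      points s n; the shift by 2 ensures s n < x from the start. Continuity of f at 0 then brings in
      f(0).\<close>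
    define s where "s n = x / real (n + 2)" for n
    have s: "0 < s n" "s n < x" for n
      using x by (auto simp: s_def field_simps intro: add_pos_nonneg)
    have "s \<longlonglongrightarrow> 0"
      unfolding s_def using LIMSEQ_ignore_initial_segment[OF lim_const_over_n[of x], of 2] by simp
    have "(\<lambda>n. f (s n)) \<longlonglongrightarrow> f 0"
      using s x T by (intro continuous_on_tendsto_compose[OF assms(6) \<open>s \<longlonglongrightarrow> 0\<close>] always_eventually)
        (auto intro: less_imp_le order_trans[OF less_imp_le[OF s(2)]])
    then have lim1: "(\<lambda>n. f x - f (s n)) \<longlonglongrightarrow> f x - f 0"
      by (intro tendsto_intros)
    have "f x - f (s n) = (\<integral>z. indicator {s n<..x} z * W z \<partial>lborel)" for n
    proof -
      have "f x - f (s n) = (LINT z:{s n<..x}|lebesgue. w z)"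
        unfolding w_def using s[of n] x T
        by (intro weak_derivative_FTC[OF has_weak_derivative_on_weak_derivative[OF assms(5)]] continuous_on_subset[OF assms(6)]) auto
      also have "\<dots> = (\<integral>z. indicator {s n<..x} z * W z \<partial>lebesgue)"
        unfolding set_lebesgue_integral_def
      proof (rule integral_cong_AE)
        have "set_integrable lebesgue {s n<..x} w"
          by (rule set_integrable_subset[OF w_int]) (use s[of n] x in auto)
        then show "(\<lambda>z. indicator {s n<..x} z *\<^sub>R w z) \<in> borel_measurable lebesgue"
          unfolding set_integrable_def by (rule borel_measurable_integrable)
        show "(\<lambda>z. indicator {s n<..x} z * W z) \<in> borel_measurable lebesgue"
          by (rule measurable_completion) simp
        show "AE z in lebesgue. indicator {s n<..x} z *\<^sub>R w z = indicator {s n<..x} z * W z"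
          using Ww by eventually_elim (use s[of n] x in \<open>auto simp: indicator_def\<close>)
      qed
      also have "\<dots> = (\<integral>z. indicator {s n<..x} z * W z \<partial>lborel)"
        by (rule integral_completion) simp
      finally show ?thesis .
    qed
    moreover have "(\<lambda>n. \<integral>z. indicator {s n<..x} z * W z \<partial>lborel) \<longlonglongrightarrow> (\<integral>y. W y * u (x - y) \<partial>lborel)"
    proof (rule integral_dominated_convergence[where w = "\<lambda>z. \<bar>W z\<bar>"])
      show "AE z in lborel. (\<lambda>n. indicator {s n<..x} z * W z) \<longlonglongrightarrow> W z * u (x - z)"
      proof (intro AE_I2)
        fix z
        show "(\<lambda>n. indicator {s n<..x} z * W z) \<longlonglongrightarrow> W z * u (x - z)"
        proof (cases "0 < z")
          case True
          then have "eventually (\<lambda>n. s n < z) sequentially"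
            using order_tendstoD(2)[OF \<open>s \<longlonglongrightarrow> 0\<close>] by simp
          then have "eventually (\<lambda>n. indicator {s n<..x} z * W z = W z * u (x - z)) sequentially"
            by eventually_elim (use True x in \<open>auto simp: u_def indicator_def\<close>)
          then show ?thesis by (rule tendsto_eventually)
        next
          case False
          then show ?thesis using W0[of z] by simp
        qed
      qed
      show "AE z in lborel. norm (indicator {s n<..x} z * W z) \<le> \<bar>W z\<bar>" for n
        by (intro AE_I2) (auto simp: indicator_def)
    qed (use W in auto)
    ultimately have "f x - f 0 = (\<integral>y. W y * u (x - y) \<partial>lborel)"
      using LIMSEQ_unique[OF lim1] by simp
    then show ?thesis by simp
  qed

  \<comment> \<open>The Caputo derivative as a multiple of V\<close>
  have ABC_eq: "ABC_derivative B \<alpha> b f y = B \<alpha> / (1 - \<alpha>) * V y" if y: "y \<in> {0<..<T}" for y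
  proof -
    have "(LINT x:{0<..<y}|lebesgue. w x * E (y - x)) = (\<integral>x. W x * k (y - x) \<partial>lebesgue)"
      unfolding set_lebesgue_integral_def
    proof (rule integral_cong_AE)
      have "set_integrable lebesgue {0<..<y} (\<lambda>x. w x * E (y - x))"
        using assms(8) y T unfolding ABC_exists_def w_def E_def by auto
      then show "(\<lambda>x. indicator {0<..<y} x *\<^sub>R (w x * E (y - x))) \<in> borel_measurable lebesgue"
        unfolding set_integrable_def by (rule borel_measurable_integrable)
      show "(\<lambda>x. W x * k (y - x)) \<in> borel_measurable lebesgue"
        by (rule measurable_completion) simp
      \<comment> \<open>At x = y the integrands may differ: the open interval omits the point,
        whereas k(0) = 1.\<close>
      have "AE x in lebesgue. x \<noteq> y"
        by (rule AE_completion) (rule AE_lborel_singleton)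
      with Ww show "AE x in lebesgue. indicator {0<..<y} x *\<^sub>R (w x * E (y - x)) = W x * k (y - x)"
      proof eventually_elim
        case (elim x)
        then show ?case
          using y W0[of x] by (cases "x \<in> {0<..<T}") (auto simp: k_def indicator_def)
      qed
    qed
    also have "\<dots> = V y"
      unfolding V_def by (rule integral_completion) simp
    finally show ?thesis
      by (simp add: ABC_derivative_def w_def E_def)
  qed

  \<comment> \<open>The Volterra identity for truncated kernels\<close>
  have conv_kp: "k s + c * (\<integral>v. k v * p (s - v) \<partial>lborel) = u s" if "s < T" for s
  proof (cases "0 < s")
    case True
    \<comment> \<open>The integrands agree except at v = 0, which k includes and the open interval
      does not.\<close>
    have "(\<integral>v. k v * p (s - v) \<partial>lborel) = (\<integral>v. indicator {0<..<s} v * (E v * (s - v) powr (\<alpha> - 1)) \<partial>lborel)"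
      using that by (intro integral_discrete_difference[of "{0}"]) (auto simp: k_def p_def indicator_def)
    then show ?thesis
      using AB_kernel_volterra[OF \<alpha> True] that True by (simp add: k_def u_def c_def E_def)
  next
    case False
    then have "k v * p (s - v) = 0" for v
      by (auto simp: k_def p_def indicator_def)
    then have "(\<integral>v. k v * p (s - v) \<partial>lborel) = 0"
      by (simp only: integral_zero)
    then show ?thesis
      using False T E0 by (auto simp: k_def u_def indicator_def)
  qed
  have Vp: "indicator {0<..<t} y * (V y * (t - y) powr (\<alpha> - 1)) = V y * p (t - y)" for y
    using V_neg[of y] T by (auto simp: p_def indicator_def)
  have Vp_int: "integrable lborel (\<lambda>y. V y * p (t - y))"
    unfolding V_def by (rule integrable_convolution_convolution[OF W p_int k_meas k_le])
  \<comment> \<open>By associativity and the Volterra identity, c times the convolution of V = W * k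
    with p is W * (u - k) at t. Here W * u gives f(t) - f(0) and W * k gives V(t) back.\<close>
  have V_inv: "V t + c * (\<integral>y. V y * p (t - y) \<partial>lborel) = f t - f 0"
  proof -
    have "c * (W x * (\<integral>v. k v * p (t - x - v) \<partial>lborel)) = W x * u (t - x) - W x * k (t - x)" for x
    proof (cases "x \<in> {0<..<T}")
      case True
      then have "k (t - x) + c * (\<integral>v. k v * p (t - x - v) \<partial>lborel) = u (t - x)"
        using T by (intro conv_kp) auto
      then have "W x * u (t - x) = W x * k (t - x) + W x * (c * (\<integral>v. k v * p (t - x - v) \<partial>lborel))"
        by (simp only: distrib_left[symmetric])
      then show ?thesis by simp
    qed (simp add: W0)
    then have "c * (\<integral>y. V y * p (t - y) \<partial>lborel) = (\<integral>x. W x * u (t - x) - W x * k (t - x) \<partial>lborel)"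
      unfolding V_def convolution_assoc[OF W p_int k_meas k_le] by (simp flip: integral_mult_right_zero)
    also have "\<dots> = (\<integral>x. W x * u (t - x) \<partial>lborel) - V t"
      unfolding V_def by (intro Bochner_Integration.integral_diff integrable_convolution_bounded[OF W u_meas u_le]
        integrable_convolution_bounded[OF W k_meas k_le])
    finally show ?thesis
      using f_eq[of t] T by simp
  qed

  \<comment> \<open>The Riemann-Liouville derivative\<close>
  define G where "G s = (LINT x:{0<..<s}|lebesgue. f x * E (s - x))" for s
  \<comment> \<open>With f = f(0) + W * u, reordering the convolutions moves the integration kernel
    u outermost. G becomes an integral of a continuous function and can be differentiated at every
    point.\<close>
  have G_eq: "G s = integral {0..s} (\<lambda>x. f 0 * E x + V x)" if s: "s \<in> {0<..<T}" for s
  proof -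
    define F where "F x = (\<integral>y. W y * u (x - y) \<partial>lborel)" for x
    have F_neg: "F x = 0" if "x \<le> 0" for x
    proof -
      have "W y * u (x - y) = 0" for y
        using that W0[of y] by (cases "y \<in> {0<..<T}") (auto simp: u_def)
      then show ?thesis by (simp only: F_def integral_zero)
    qed
    have refl: "(\<integral>v. u v * k (r - v) \<partial>lborel) = (\<integral>v. k v * u (r - v) \<partial>lborel)" for r
      by (subst lborel_integral_real_affine[of "-1" _ r]) (simp_all add: mult.commute)
    have uk_int: "integrable lborel (\<lambda>v. u v * k (s - v))"
      by (rule integrable_convolution_bounded[OF u_int k_meas k_le])
    have ku_int: "integrable lborel (\<lambda>v. k v * u (s - v))"
      by (rule integrable_convolution_bounded[OF k_int u_meas u_le])
    have Fk_int: "integrable lborel (\<lambda>x. F x * k (s - x))"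
      unfolding F_def by (rule integrable_convolution_convolution[OF W k_int u_meas u_le])
    have Vu_int: "integrable lborel (\<lambda>x. V x * u (s - x))"
      unfolding V_def by (rule integrable_convolution_convolution[OF W u_int k_meas k_le])
    have "G s = (\<integral>x. f 0 * (u x * k (s - x)) + F x * k (s - x) \<partial>lebesgue)"
      unfolding G_def set_lebesgue_integral_def
    \<comment> \<open>The truncated kernels are nonzero at the end points 0 and s, which the open
      interval omits.\<close>
    proof (rule integral_discrete_difference[of "{0, s}"])
      fix x assume "x \<notin> {0, s}"
      then consider "x < 0" | "0 < x" "x < s" | "s < x" by fastforce
      then show "indicator {0<..<s} x *\<^sub>R (f x * E (s - x)) = f 0 * (u x * k (s - x)) + F x * k (s - x)"
      proof cases
        case 2
        then have "f x = f 0 + F x" "u x = 1" "k (s - x) = E (s - x)"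
          using s f_eq[of x] by (auto simp: F_def u_def k_def)
        then show ?thesis using 2 by (simp add: algebra_simps)
      qed (use s F_neg[of x] in \<open>auto simp: u_def k_def\<close>)
    qed auto
    also have "\<dots> = (\<integral>x. f 0 * (u x * k (s - x)) + F x * k (s - x) \<partial>lborel)"
      using uk_int Fk_int by (intro integral_completion borel_measurable_integrable) auto
    also have "\<dots> = f 0 * (\<integral>x. u x * k (s - x) \<partial>lborel) + (\<integral>x. F x * k (s - x) \<partial>lborel)"
      using uk_int Fk_int by simp
    also have "\<dots> = f 0 * (\<integral>x. k x * u (s - x) \<partial>lborel) + (\<integral>x. V x * u (s - x) \<partial>lborel)"
      unfolding F_def V_def convolution_assoc[OF W k_int u_meas u_le] convolution_assoc[OF W u_int k_meas k_le] refl ..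
    also have "\<dots> = (\<integral>x. f 0 * (k x * u (s - x)) + V x * u (s - x) \<partial>lborel)"
      using ku_int Vu_int by simp
    also have "\<dots> = (LINT x:{0..s}|lborel. f 0 * E x + V x)"
      unfolding set_lebesgue_integral_def
    proof (rule Bochner_Integration.integral_cong[OF HOL.refl])
      fix x
      show "f 0 * (k x * u (s - x)) + V x * u (s - x) = indicator {0..s} x *\<^sub>R (f 0 * E x + V x)"
        using s V_neg[of x] by (auto simp: k_def u_def indicator_def)
    qed
    also have "\<dots> = integral {0..s} (\<lambda>x. f 0 * E x + V x)"
      by (intro set_borel_integral_eq_integral borel_integrable_atLeastAtMost' continuous_intros
          continuous_on_subset[OF Econt] continuous_at_imp_continuous_on ballI V_cont) auto
    finally show ?thesis .
  qed
  have ABR_eq: "ABR_derivative B \<alpha> f y = B \<alpha> / (1 - \<alpha>) * (f 0 * E y + V y)" if y: "y \<in> {0<..<T}" for y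
  proof -
    have "continuous_on {0..T} (\<lambda>x. f 0 * E x + V x)"
      by (intro continuous_intros continuous_on_subset[OF Econt] continuous_at_imp_continuous_on ballI V_cont) auto
    then have "((\<lambda>s. integral {0..s} (\<lambda>x. f 0 * E x + V x)) has_real_derivative f 0 * E y + V y) (at y within {0..T})"
      by (rule integral_has_real_derivative) (use y in auto)
    then have "((\<lambda>s. integral {0..s} (\<lambda>x. f 0 * E x + V x)) has_real_derivative f 0 * E y + V y) (at y)"
      using y by (simp add: at_within_Icc_at)
    then have "(G has_real_derivative f 0 * E y + V y) (at y)"
      by (rule has_field_derivative_transform_within_open[where S = "{0<..<T}"]) (use y G_eq in auto)
    then show ?thesis
      by (simp add: ABR_derivative_def G_def[abs_def] E_def DERIV_imp_deriv)
  qed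

  \<comment> \<open>Both inversion formulas\<close>
  have Ep_int: "integrable lborel (\<lambda>y. indicator {0<..<t} y * (E y * (t - y) powr (\<alpha> - 1)))"
  proof -
    \<comment> \<open>Integrable p against bounded k; the reflection y = t - x then yields the
      required form.\<close>
    have "integrable lborel (\<lambda>x. p x * k (t - x))"
      by (rule integrable_convolution_bounded[OF p_int k_meas k_le])
    from lborel_integrable_real_affine[OF this, of "-1" t]
    have "integrable lborel (\<lambda>y. p (t - y) * k y)" by simp
    also have "?this \<longleftrightarrow> ?thesis"
      using T by (intro integrable_discrete_difference[of "{0}"]) (auto simp: k_def p_def indicator_def)
    finally show ?thesis .
  qed
  have V2p: "indicator {0<..<t} y * ((f 0 * E y + V y) * (t - y) powr (\<alpha> - 1)) =
      f 0 * (indicator {0<..<t} y * (E y * (t - y) powr (\<alpha> - 1))) + V y * p (t - y)" for y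
    unfolding Vp[symmetric] by (simp add: algebra_simps)
  \<comment> \<open>Multiplied by f(0), the Volterra identity settles the summand f(0) E; together
    with f(t) - f(0) from \<open>V_inv\<close> the total is f(t).\<close>
  have "E t + c * (\<integral>y. indicator {0<..<t} y * (E y * (t - y) powr (\<alpha> - 1)) \<partial>lborel) = 1"
    using AB_kernel_volterra[OF \<alpha> T(4)] by (simp add: c_def E_def)
  then have "f 0 * (E t + c * (\<integral>y. indicator {0<..<t} y * (E y * (t - y) powr (\<alpha> - 1)) \<partial>lborel)) = f 0"
    by simp
  with V_inv have R: "(f 0 * E t + V t) + c *
      (\<integral>y. indicator {0<..<t} y * ((f 0 * E y + V y) * (t - y) powr (\<alpha> - 1)) \<partial>lborel) = f t"
    unfolding V2p Bochner_Integration.integral_add[OF integrable_mult_right[OF Ep_int] Vp_int] integral_mult_right_zero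
    by (simp only: distrib_left mult.left_commute)
  have ABR_on: "ABR_derivative B \<alpha> f y = B \<alpha> / (1 - \<alpha>) * (f 0 * E y + V y)"
    and ABC_on: "ABC_derivative B \<alpha> b f y = B \<alpha> / (1 - \<alpha>) * V y" if "y \<in> {0<..t}" for y
    using that T ABR_eq[of y] ABC_eq[of y] by auto
  have V2p_int: "integrable lborel (\<lambda>y. indicator {0<..<t} y * ((f 0 * E y + V y) * (t - y) powr (\<alpha> - 1)))"
    unfolding V2p using Ep_int Vp_int by (intro Bochner_Integration.integrable_add integrable_mult_right)
  have "AB_integral_exists \<alpha> (ABR_derivative B \<alpha> f) t" "AB_integral B \<alpha> (ABR_derivative B \<alpha> f) t = f t"
    using AB_integral_eqI[where B = B and V = "\<lambda>y. f 0 * E y + V y", OF \<alpha> assms(4) T(4) ABR_on V2p_int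
        R[unfolded c_def]] by simp_all
  moreover have "AB_integral_exists \<alpha> (ABC_derivative B \<alpha> b f) t"
    "AB_integral B \<alpha> (ABC_derivative B \<alpha> b f) t = f t - f 0"
    using AB_integral_eqI[where B = B and V = V, OF \<alpha> assms(4) T(4) ABC_on Vp_int[folded Vp]
        V_inv[folded Vp, unfolded c_def]] by simp_all
  ultimately show "AB_integral_exists \<alpha> (ABR_derivative B \<alpha> f) t \<and>
      AB_integral B \<alpha> (ABR_derivative B \<alpha> f) t = f t \<and>
      AB_integral_exists \<alpha> (ABC_derivative B \<alpha> b f) t \<and>
      AB_integral B \<alpha> (ABC_derivative B \<alpha> b f) t = f t - f 0"
    by blast
qed

end
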